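(* Let $\mathbb{F}\in\{\mathbb{R},\mathbb{C}\}$ and let $\nu\in\mathbb{F}^{d_0}$ be an isotropic random vector satisfying $\mathbb{E}|\langle\nu,a\rangle|^4\le C_\nu$ for every unit vector $a\in\mathbb{F}^{d_0}$. For a tensor order $\ell$, the Khatri–Rao test matrix $\Omega\in\mathbb{F}^{d_0^\ell\times k}$ with base distribution $\nu$ is an $(r,1/2)$-OSI for some embedding dimension $k = O(C_\nu^{\ell} r)$ (with a universal constant in $O(\cdot)$).
   Context: Isotropic means $\mathbb{E}[\nu\nu^*]=I$; $\langle x,y\rangle = x^*y$. The Khatri–Rao test matrix is $\Omega = k^{-1/2}[\omega_1,\dots,\omega_k]$ with $\omega_j = \omega_j^{(1)}\otimes\cdots\otimes\omega_j^{(\ell)}\in\mathbb{F}^{d_0^\ell}$, where all $\omega_j^{(i)}$ are iid copies of $\nu$ and $\otimes$ is the Kronecker product. A random matrix $\Omega\in\mathbb{F}^{d\times k}$ is an $(r,\alpha)$-OSI ($k\ge r$, $\alpha\in(0,1]$) if (1) $\mathbb{E}\|\Omega^*x\|_2^2=\|x\|_2^2$ for all $x\in\mathbb{F}^d$; and (2) for each fixed $r$-dimensional subspace $V\subseteq\mathbb{F}^d$, with probability at least $19/20$, $\alpha\|x\|_2^2\le\|\Omega^*x\|_2^2$ for all $x\in V$. *)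

theory Defs
  imports "HOL-Probability.Probability" "Jordan_Normal_Form.Schur_Decomposition"
    "Jordan_Normal_Form.VS_Connect"
begin

unbundle no vec_syntax

text \<open>Vectors and matrices are those of Jordan Normal Form, whose dimensions are natural numbers,
  so that one universal constant can serve all dimensions. The definitions are generic in the
  scalars and are meant for \<^typ>\<open>real\<close> and \<^typ>\<open>complex\<close>, for which \<^const>\<open>conjugate\<close> is the identity
  and complex conjugation, respectively.\<close>

definition vec_borel :: "nat \<Rightarrow> 'a :: topological_space vec measure" where
  "vec_borel n =
     vimage_algebra (carrier_vec n) (\<lambda>v. \<lambda>i\<in>{..<n}. v $ i) (\<Pi>\<^sub>M i\<in>{..<n}. borel)"

definition l2_norm :: "'a :: real_normed_vector vec \<Rightarrow> real" where
  "l2_norm v = sqrt (\<Sum>i<dim_vec v. (norm (v $ i))\<^sup>2)"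

text \<open>A random vector enters only through its distribution, a probability measure on the Borel
  sets of the vectors of dimension \<open>d\<close>.\<close>

definition vec_distribution :: "nat \<Rightarrow> 'a :: topological_space vec measure \<Rightarrow> bool" where
  "vec_distribution d N \<longleftrightarrow> prob_space N \<and> sets N = sets (vec_borel d)"

definition isotropic ::
  "nat \<Rightarrow> 'a :: {conjugatable_field, real_normed_field, banach, second_countable_topology} vec measure
    \<Rightarrow> bool" where
  "isotropic d N \<longleftrightarrow>
     (\<forall>i<d. \<forall>j<d. integrable N (\<lambda>v. v $ i * conjugate (v $ j))) \<and>
     mat d d (\<lambda>(i, j). \<integral>v. v $ i * conjugate (v $ j) \<partial>N) = 1\<^sub>m d"

text \<open>Here \<open>a \<bullet>c v\<close> is the sum of the \<open>a $ i * conjugate (v $ i)\<close>, that is, the inner product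
  of \<open>v\<close> and \<open>a\<close> that is conjugate linear in \<open>v\<close>. Integrability is part of the bound, because the
  Bochner integral of a non-integrable function is 0.\<close>

definition fourth_moment_bound ::
  "nat \<Rightarrow> 'a :: {conjugatable_field, real_normed_field} vec measure \<Rightarrow> real \<Rightarrow> bool" where
  "fourth_moment_bound d N C \<longleftrightarrow>
     (\<forall>a\<in>carrier_vec d. l2_norm a = 1 \<longrightarrow>
        integrable N (\<lambda>v. norm (a \<bullet>c v) ^ 4) \<and> (\<integral>v. norm (a \<bullet>c v) ^ 4 \<partial>N) \<le> C)"

definition kron_vec :: "'a :: times vec \<Rightarrow> 'a vec \<Rightarrow> 'a vec" (infixr "\<otimes>\<^sub>v" 70) where
  "u \<otimes>\<^sub>v v = vec (dim_vec u * dim_vec v) (\<lambda>i. u $ (i div dim_vec v) * v $ (i mod dim_vec v))"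

text \<open>The trailing factor \<open>(1)\<close> of dimension 1 is neutral for \<^const>\<open>kron_vec\<close>.\<close>

definition kron_list :: "'a :: monoid_mult vec list \<Rightarrow> 'a vec" where
  "kron_list vs = foldr (\<otimes>\<^sub>v) vs (vec 1 (\<lambda>_. 1))"

text \<open>\<open>w (j, i)\<close> is the \<open>i\<close>-th Kronecker factor of the \<open>j\<close>-th column, both counted from 0.\<close>

definition khatri_rao_mat ::
  "nat \<Rightarrow> nat \<Rightarrow> nat \<Rightarrow> (nat \<times> nat \<Rightarrow> 'a :: real_normed_field vec) \<Rightarrow> 'a mat" where
  "khatri_rao_mat d0 l k w =
     of_real (1 / sqrt (real k)) \<cdot>\<^sub>m
       mat_of_cols (d0 ^ l) (map (\<lambda>j. kron_list (map (\<lambda>i. w (j, i)) [0..<l])) [0..<k])"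

text \<open>The sample space carrying the \<open>k * l\<close> factors as its coordinates, which are iid with
  distribution \<open>N\<close>.\<close>

definition factor_space ::
  "nat \<Rightarrow> nat \<Rightarrow> 'a vec measure \<Rightarrow> (nat \<times> nat \<Rightarrow> 'a vec) measure" where
  "factor_space l k N = (\<Pi>\<^sub>M ji\<in>{..<k} \<times> {..<l}. N)"

definition random_mat ::
  "'w measure \<Rightarrow> nat \<Rightarrow> nat \<Rightarrow> ('w \<Rightarrow> 'a :: topological_space mat) \<Rightarrow> bool" where
  "random_mat M d k \<Omega> \<longleftrightarrow> prob_space M \<and>
     (\<forall>w\<in>space M. \<Omega> w \<in> carrier_mat d k) \<and>
     (\<forall>i<d. \<forall>j<k. (\<lambda>w. \<Omega> w $$ (i, j)) \<in> borel_measurable M)"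

definition subspace_of_dim :: "nat \<Rightarrow> nat \<Rightarrow> 'a :: field vec set \<Rightarrow> bool" where
  "subspace_of_dim d r V \<longleftrightarrow>
     VectorSpace.subspace class_ring V (module_vec TYPE('a) d) \<and>
     vectorspace.dim class_ring ((module_vec TYPE('a) d)\<lparr>carrier := V\<rparr>) = r"

definition osi ::
  "'w measure \<Rightarrow> nat \<Rightarrow> nat \<Rightarrow> ('w \<Rightarrow> 'a :: {conjugatable_field, real_normed_field} mat)
    \<Rightarrow> nat \<Rightarrow> real \<Rightarrow> bool" where
  "osi M d k \<Omega> r \<alpha> \<longleftrightarrow>
     random_mat M d k \<Omega> \<and> r \<le> k \<and> 0 < \<alpha> \<and> \<alpha> \<le> 1 \<and>
     (\<forall>x\<in>carrier_vec d.
        integrable M (\<lambda>w. (l2_norm (mat_adjoint (\<Omega> w) *\<^sub>v x))\<^sup>2) \<and>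
        (\<integral>w. (l2_norm (mat_adjoint (\<Omega> w) *\<^sub>v x))\<^sup>2 \<partial>M) = (l2_norm x)\<^sup>2) \<and>
     (\<forall>V. subspace_of_dim d r V \<longrightarrow>
        measure M {w \<in> space M.
          \<forall>x\<in>V. \<alpha> * (l2_norm x)\<^sup>2 \<le> (l2_norm (mat_adjoint (\<Omega> w) *\<^sub>v x))\<^sup>2} \<ge> 19 / 20)"

end

theory Submission
  imports Defs
begin

text \<open>The fourth moment bound tensorizes: conditioning on all factors but one and using
  Cauchy-Schwarz for the rest, a column \<open>\<omega>\<close> satisfies \<open>E \<bar>\<langle>\<omega>, x\<rangle>\<bar>\<^sup>4 \<le> C ^ l * \<parallel>x\<parallel>\<^sup>4\<close>. As the
  summands \<open>\<bar>\<langle>\<omega>\<^sub>j, x\<rangle>\<bar>\<^sup>2\<close> are nonnegative, \<open>exp (- t) \<le> 1 - t + t\<^sup>2 / 2\<close> turns this into the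
  subgaussian lower tail \<open>P (\<parallel>\<Omega>\<^sup>* x\<parallel>\<^sup>2 < 3 / 4 * \<parallel>x\<parallel>\<^sup>2) \<le> exp (- k / (32 * C ^ l))\<close> for every fixed
  \<open>x\<close>. A union bound makes \<open>q x = \<parallel>\<Omega>\<^sup>* x\<parallel>\<^sup>2 - 3 / 4 * \<parallel>x\<parallel>\<^sup>2\<close> nonnegative on the
  \<open>exp (O r)\<close> points of a grid of mesh of order \<open>r powr (- 1 / 2)\<close> in the subspace.

  The upper tail is too heavy for an epsilon-net argument. Instead, a unit vector is rounded to the
  grid at random and without bias, which changes the expectation of the quadratic form \<open>q\<close> only by
  a multiple of the squared mesh times its trace, and Markov's inequality controls the trace by its
  mean. The same rounding with mesh tending to \<open>0\<close> shows that the embedding event is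
  measurable.\<close>

section \<open>Scalars and quadratic forms\<close>

text \<open>Real and complex scalars are treated at once. Over the reals \<open>j = 0\<close> serves as imaginary
  unit, which is why its norm is only bounded by \<open>1\<close>.\<close>

class real_or_complex = conjugatable_ordered_field + real_normed_field + banach +
  second_countable_topology +
  assumes norm_square_scaleR: "(norm x)\<^sup>2 *\<^sub>R 1 = x * conjugate x"
    and conjugate_scaleR: "conjugate (t *\<^sub>R x) = t *\<^sub>R conjugate x"
    and ex_imaginary_scaleR:
      "\<exists>j. norm j \<le> 1 \<and> (\<forall>z. \<exists>a b. z = a *\<^sub>R 1 + b *\<^sub>R j \<and> a\<^sup>2 + b\<^sup>2 \<le> (norm z)\<^sup>2)"

instance real :: real_or_complex
proof
  fix x t :: real
  show "(norm x)\<^sup>2 *\<^sub>R 1 = x * conjugate x"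
    by (simp add: power2_eq_square)
  show "conjugate (t *\<^sub>R x) = t *\<^sub>R conjugate x"
    by simp
  have "\<forall>z::real. \<exists>a b. z = a *\<^sub>R 1 + b *\<^sub>R 0 \<and> a\<^sup>2 + b\<^sup>2 \<le> (norm z)\<^sup>2"
  proof
    fix z :: real
    show "\<exists>a b. z = a *\<^sub>R 1 + b *\<^sub>R 0 \<and> a\<^sup>2 + b\<^sup>2 \<le> (norm z)\<^sup>2"
      by (rule exI[of _ z], rule exI[of _ 0]) simp
  qed
  then show "\<exists>j::real. norm j \<le> 1 \<and>
      (\<forall>z. \<exists>a b. z = a *\<^sub>R 1 + b *\<^sub>R j \<and> a\<^sup>2 + b\<^sup>2 \<le> (norm z)\<^sup>2)"
    by (intro exI[of _ 0]) simp
qed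

instance complex :: real_or_complex
proof
  fix x :: complex and t :: real
  show "(norm x)\<^sup>2 *\<^sub>R 1 = x * conjugate x"
    by (simp add: complex_norm_square[symmetric] scaleR_conv_of_real)
  show "conjugate (t *\<^sub>R x) = t *\<^sub>R conjugate x"
    by simp
  have "\<forall>z::complex. \<exists>a b. z = a *\<^sub>R 1 + b *\<^sub>R \<i> \<and> a\<^sup>2 + b\<^sup>2 \<le> (norm z)\<^sup>2"
  proof
    fix z :: complex
    show "\<exists>a b. z = a *\<^sub>R 1 + b *\<^sub>R \<i> \<and> a\<^sup>2 + b\<^sup>2 \<le> (norm z)\<^sup>2"
      by (rule exI[of _ "Re z"], rule exI[of _ "Im z"])
        (simp add: cmod_power2 complex_eq_iff)
  qed
  then show "\<exists>j::complex. norm j \<le> 1 \<and>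
      (\<forall>z. \<exists>a b. z = a *\<^sub>R 1 + b *\<^sub>R j \<and> a\<^sup>2 + b\<^sup>2 \<le> (norm z)\<^sup>2)"
    by (intro exI[of _ \<i>]) simp
qed

text \<open>Identities between squared norms are proved below by moving them into the scalar field,
  where they become ring identities, and then cancelling the injective
  \<open>of_real\<close>.\<close>

lemma of_real_norm_square: "of_real ((norm x)\<^sup>2) = x * conjugate (x :: 'a :: real_or_complex)"
  by (simp only: of_real_def norm_square_scaleR)

text \<open>A nonzero idempotent of a field equals 1, and multiplicativity makes
  \<open>conjugate 1\<close> one.\<close>

lemma conjugate_one [simp]: "conjugate (1 :: 'a :: real_or_complex) = 1"
proof -
  have "conjugate (1 :: 'a) * 1 = conjugate 1 * conjugate 1"
    by (simp only: conjugate_dist_mul[symmetric] mult_1_right)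
  moreover have "conjugate (1 :: 'a) \<noteq> 0"
    by simp
  ultimately show ?thesis
    by (metis mult_left_cancel)
qed

lemma conjugate_of_real [simp]: "conjugate (of_real t :: 'a :: real_or_complex) = of_real t"
  by (simp add: of_real_def conjugate_scaleR)

lemma ex_imaginary_unit:
  "\<exists>j :: 'a :: real_or_complex. norm j \<le> 1 \<and>
     (\<forall>z. \<exists>a b. z = of_real a + of_real b * j \<and> a\<^sup>2 + b\<^sup>2 \<le> (norm z)\<^sup>2)"
  using ex_imaginary_scaleR[where 'a = 'a] by (simp add: of_real_def)

lemma norm_conjugate [simp]: "norm (conjugate x :: 'a :: real_or_complex) = norm x"
proof -
  have "(of_real ((norm (conjugate x))\<^sup>2) :: 'a) = of_real ((norm x)\<^sup>2)"
    by (simp only: of_real_norm_square conjugate_id mult.commute)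
  then have "(norm (conjugate x))\<^sup>2 = (norm x)\<^sup>2"
    by (simp only: of_real_eq_iff)
  then show ?thesis
    by simp
qed

lemma continuous_conjugate: "continuous_on A (conjugate :: 'a :: real_or_complex \<Rightarrow> 'a)"
proof (rule continuous_onI)
  fix x :: 'a and e :: real
  assume "e > 0"
  have "dist (conjugate y) (conjugate x) = dist y x" for y :: 'a
    by (metis norm_conjugate conjugate_dist_add conjugate_neg dist_norm uminus_add_conv_diff
        add.commute)
  then show "\<exists>d>0. \<forall>y\<in>A. dist y x < d \<longrightarrow> dist (conjugate y) (conjugate x) \<le> e"
    using \<open>e > 0\<close> by (intro exI[of _ e]) auto
qed

lemma borel_measurable_conjugate [measurable]:
  "(conjugate :: 'a :: real_or_complex \<Rightarrow> 'a) \<in> borel_measurable borel"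
  by (rule borel_measurable_continuous_onI[OF continuous_conjugate])

text \<open>Second moment equals squared mean plus variance, for the two-point distribution with
  weight \<open>t\<close> on \<open>x\<close> and \<open>1 - t\<close> on \<open>y\<close>.\<close>

lemma norm_convex_combination_square:
  fixes x y :: "'a :: real_or_complex"
  shows "t * (norm x)\<^sup>2 + (1 - t) * (norm y)\<^sup>2
    = (norm (of_real t * x + of_real (1 - t) * y))\<^sup>2 + t * (1 - t) * (norm (x - y))\<^sup>2"
proof -
  have neg: "conjugate (x - y) = conjugate x - conjugate y"
    by (metis conjugate_dist_add conjugate_neg diff_conv_add_uminus)
  have "(of_real (t * (norm x)\<^sup>2 + (1 - t) * (norm y)\<^sup>2) :: 'a)
      = of_real t * (x * conjugate x) + (1 - of_real t) * (y * conjugate y)"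
    by (simp only: of_real_add of_real_mult of_real_diff of_real_1 of_real_norm_square)
  also have "\<dots> = (of_real t * x + (1 - of_real t) * y)
      * (of_real t * conjugate x + (1 - of_real t) * conjugate y)
      + of_real t * (1 - of_real t) * ((x - y) * (conjugate x - conjugate y))"
    by (simp add: algebra_simps)
  also have "\<dots> = (of_real t * x + of_real (1 - t) * y)
      * conjugate (of_real t * x + of_real (1 - t) * y)
      + of_real t * of_real (1 - t) * ((x - y) * conjugate (x - y))"
    unfolding conjugate_dist_add conjugate_dist_mul conjugate_of_real neg
    by (simp only: of_real_diff of_real_1)
  also have "\<dots> = of_real ((norm (of_real t * x + of_real (1 - t) * y))\<^sup>2
      + t * (1 - t) * (norm (x - y))\<^sup>2)"
    by (simp only: of_real_add of_real_mult of_real_norm_square)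
  finally show ?thesis
    by (simp only: of_real_eq_iff)
qed

text \<open>What rounding needs of a quadratic form in \<open>m\<close> real variables. For a
  genuine form the inequality is an equality with \<open>A i\<close> the \<open>i\<close>-th
  diagonal entry; asking only for an upper bound lets a subtracted nonnegative form be left out of
  \<open>A\<close>.\<close>

definition diag_bounded_quadratic :: "nat \<Rightarrow> (nat \<Rightarrow> real) \<Rightarrow> ((nat \<Rightarrow> real) \<Rightarrow> real) \<Rightarrow> bool" where
  "diag_bounded_quadratic m A q \<longleftrightarrow>
     (\<forall>v v'. (\<forall>i<m. v i = v' i) \<longrightarrow> q v = q v') \<and>
     (\<forall>v i a b t. i < m \<longrightarrow> 0 \<le> t \<longrightarrow> t \<le> 1 \<longrightarrow>
        t * q (v(i := a)) + (1 - t) * q (v(i := b))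
          \<le> q (v(i := t * a + (1 - t) * b)) + t * (1 - t) * (a - b)\<^sup>2 * A i)"

text \<open>Derandomized unbiased rounding: rounding a coordinate up or down at random, with mean its
  value, raises the mean of a quadratic form only by the variance times the diagonal entry.\<close>

lemma ex_rounding:
  assumes q: "diag_bounded_quadratic m A q" and A: "\<And>i. i < m \<Longrightarrow> 0 \<le> A i" and s: "0 < s"
  obtains z :: "nat \<Rightarrow> int" where
    "\<And>i. i < m \<Longrightarrow> \<bar>s * of_int (z i) - v i\<bar> \<le> s"
    "q (\<lambda>i. s * of_int (z i)) \<le> q v + s\<^sup>2 / 4 * (\<Sum>i<m. A i)"
proof -
  \<comment> \<open>Coordinates are rounded one at a time: after \<open>n\<close> steps those below
    \<open>n\<close> lie on the grid and the others still agree with \<open>v\<close>.\<close>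
  have step: "n \<le> m \<Longrightarrow> \<exists>(z :: nat \<Rightarrow> int). (\<forall>i<n. \<bar>s * of_int (z i) - v i\<bar> \<le> s) \<and>
     q (\<lambda>i. if i < n then s * of_int (z i) else v i) \<le> q v + s\<^sup>2 / 4 * (\<Sum>i<n. A i)" for n
  proof (induction n)
    case 0
    then show ?case by simp
  next
    case (Suc n)
    then have n: "n < m" and "\<exists>(z :: nat \<Rightarrow> int). (\<forall>i<n. \<bar>s * of_int (z i) - v i\<bar> \<le> s) \<and>
     q (\<lambda>i. if i < n then s * of_int (z i) else v i) \<le> q v + s\<^sup>2 / 4 * (\<Sum>i<n. A i)"
      by auto
    then obtain z :: "nat \<Rightarrow> int" where z: "\<forall>i<n. \<bar>s * of_int (z i) - v i\<bar> \<le> s"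
      "q (\<lambda>i. if i < n then s * of_int (z i) else v i) \<le> q v + s\<^sup>2 / 4 * (\<Sum>i<n. A i)"
      by blast
    define w where "w = (\<lambda>i. if i < n then s * of_int (z i) else v i)"
    \<comment> \<open>\<open>b\<close> and \<open>a\<close> are the neighbouring grid points with
      \<open>b \<le> v n < a\<close>, and \<open>t\<close> is the weight on \<open>a\<close> that
      makes the two-point mean equal to \<open>v n\<close>.\<close>
    define c where "c = \<lfloor>v n / s\<rfloor>"
    define b where "b = s * of_int c"
    define a where "a = s * of_int (c + 1)"
    define t where "t = v n / s - of_int c"
    have t: "0 \<le> t" "t \<le> 1"
      unfolding t_def c_def by linarith+
    have ab: "a - b = s"
      by (simp add: a_def b_def algebra_simps)
    have comb: "t * a + (1 - t) * b = v n"
      using s by (simp add: t_def a_def b_def field_simps)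
    have va: "v n = b + t * s"
      using comb ab by (simp add: algebra_simps) 
    have near: "\<bar>a - v n\<bar> \<le> s" "\<bar>b - v n\<bar> \<le> s"
    proof -
      have "0 \<le> t * s" "t * s \<le> s"
        using t s by (auto simp: mult_left_le_one_le)
      then show "\<bar>a - v n\<bar> \<le> s" "\<bar>b - v n\<bar> \<le> s"
        using va ab by linarith+
    qed
    have wn: "w(n := v n) = w"
      by (auto simp: w_def)
    have "t * q (w(n := a)) + (1 - t) * q (w(n := b)) \<le> q w + t * (1 - t) * s\<^sup>2 * A n"
      using q n t ab comb wn unfolding diag_bounded_quadratic_def by metis
    also have "\<dots> \<le> q w + s\<^sup>2 / 4 * A n"
    proof -
      \<comment> \<open>The variance factor \<open>t * (1 - t)\<close> peaks at
        \<open>t = 1 / 2\<close>; this is the source of the \<open>1 / 4\<close> in the error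
        term.\<close>
      have "0 \<le> (t - 1 / 2)\<^sup>2"
        by simp
      then have "t * (1 - t) \<le> 1 / 4"
        by (simp add: power2_eq_square algebra_simps)
      then have "t * (1 - t) * (s\<^sup>2 * A n) \<le> 1 / 4 * (s\<^sup>2 * A n)"
        using A[OF n] by (intro mult_right_mono) auto
      then show ?thesis
        by simp
    qed
    finally have avg: "t * q (w(n := a)) + (1 - t) * q (w(n := b)) \<le> q w + s\<^sup>2 / 4 * A n" .
    \<comment> \<open>The smaller of two values is at most their weighted average, so one of the two
      roundings respects the bound.\<close>
    have "q (w(n := a)) \<le> q w + s\<^sup>2 / 4 * A n \<or> q (w(n := b)) \<le> q w + s\<^sup>2 / 4 * A n"
    proof (rule ccontr)
      define R where "R = q w + s\<^sup>2 / 4 * A n"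
      assume "\<not> ?thesis"
      then have "q (w(n := a)) > R" "q (w(n := b)) > R"
        unfolding R_def by auto
      then have "t * R + (1 - t) * R < t * q (w(n := a)) + (1 - t) * q (w(n := b))"
        using t by (cases "t = 0") (auto intro!: add_less_le_mono mult_strict_left_mono mult_left_mono)
      then show False
        using avg unfolding R_def[symmetric] by (simp add: algebra_simps)
    qed
    then obtain y where y: "y \<in> {c, c + 1}" "q (w(n := s * of_int y)) \<le> q w + s\<^sup>2 / 4 * A n"
      unfolding a_def b_def by blast
    have "(\<lambda>i. if i < Suc n then s * of_int ((z(n := y)) i) else v i) = w(n := s * of_int y)"
      by (auto simp: w_def fun_eq_iff)
    moreover have "\<forall>i<Suc n. \<bar>s * of_int ((z(n := y)) i) - v i\<bar> \<le> s"
      using z near y(1) unfolding a_def b_def by (auto simp: less_Suc_eq)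
    moreover have "q (w(n := s * of_int y)) \<le> q v + s\<^sup>2 / 4 * (\<Sum>i<Suc n. A i)"
      using y(2) z(2) unfolding w_def[symmetric] sum.lessThan_Suc distrib_left by linarith
    ultimately show ?case
      by (intro exI[of _ "z(n := y)"]) presburger
  qed
  obtain z :: "nat \<Rightarrow> int" where z: "\<forall>i<m. \<bar>s * of_int (z i) - v i\<bar> \<le> s"
    "q (\<lambda>i. if i < m then s * of_int (z i) else v i) \<le> q v + s\<^sup>2 / 4 * (\<Sum>i<m. A i)"
    using step[of m] by auto
  have "q (\<lambda>i. if i < m then s * of_int (z i) else v i) = q (\<lambda>i. s * of_int (z i))"
    using q unfolding diag_bounded_quadratic_def by simp
  with z that show ?thesis
    by auto
qed

section \<open>Counting grid points\<close>

text \<open>The two-sided geometric series over all integers sums to 3. It is the total weight of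
  one coordinate when lattice points are counted.\<close>

lemma sum_half_power_abs: "(\<Sum>y = - int B..int B. (1 / 2 :: real) ^ nat \<bar>y\<bar>) \<le> 3"
proof -
  have "(\<Sum>y = - int B..int B. (1 / 2 :: real) ^ nat \<bar>y\<bar>) = 3 - 2 * (1 / 2) ^ B"
  proof (induction B)
    case (Suc B)
    have "{- int (Suc B)..int (Suc B)} = insert (- int (Suc B)) (insert (int (Suc B)) {- int B..int B})"
      by auto
    then show ?case
      using Suc by (simp add: nat_add_distrib)
  qed simp
  then show ?thesis
    by simp
qed

text \<open>Bounding the sum of the coordinates rather than each of them keeps the count exponential
  in \<open>m\<close>: single coordinates of a rounded unit vector can be of order
  \<open>sqrt m\<close>, and a box of that size would have about \<open>sqrt m ^ m\<close> points.
  Extensional functions make the set finite.\<close>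

definition l1_ball :: "nat \<Rightarrow> nat \<Rightarrow> (nat \<Rightarrow> int) set" where
  "l1_ball m B = {z \<in> {..<m} \<rightarrow>\<^sub>E UNIV. (\<Sum>i<m. nat \<bar>z i\<bar>) \<le> B}"

lemma l1_ball_subset: "l1_ball m B \<subseteq> {..<m} \<rightarrow>\<^sub>E {- int B..int B}"
proof
  fix z
  assume z: "z \<in> l1_ball m B"
  have "z i \<in> {- int B..int B}" if "i < m" for i
  proof -
    have "nat \<bar>z i\<bar> \<le> (\<Sum>i<m. nat \<bar>z i\<bar>)"
      using that by (intro member_le_sum) auto
    then have "nat \<bar>z i\<bar> \<le> B"
      using z by (simp add: l1_ball_def)
    then show ?thesis
      by auto
  qed
  then show "z \<in> {..<m} \<rightarrow>\<^sub>E {- int B..int B}"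
    using z by (auto simp: l1_ball_def PiE_def)
qed

lemma finite_l1_ball: "finite (l1_ball m B)"
  by (rule finite_subset[OF l1_ball_subset], rule finite_PiE) simp_all

text \<open>Each point of the ball has weight at least \<open>1\<close> under the product weight
  \<open>2 ^ (B - \<Sum>i. \<bar>z i\<bar>)\<close>.\<close>

lemma card_l1_ball: "real (card (l1_ball m B)) \<le> 3 ^ m * 2 ^ B"
proof -
  have "real (card (l1_ball m B)) = (\<Sum>z\<in>l1_ball m B. 1)"
    by simp
  also have "\<dots> \<le> (\<Sum>z\<in>l1_ball m B. 2 ^ B * (\<Prod>i<m. (1 / 2) ^ nat \<bar>z i\<bar>))"
  proof (rule sum_mono)
    fix z
    assume "z \<in> l1_ball m B"
    then have "(\<Sum>i<m. nat \<bar>z i\<bar>) \<le> B"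
      by (simp add: l1_ball_def)
    then have "(2 :: real) ^ (\<Sum>i<m. nat \<bar>z i\<bar>) \<le> 2 ^ B"
      by (intro power_increasing) auto
    then have "1 \<le> (2 :: real) ^ B * (1 / 2) ^ (\<Sum>i<m. nat \<bar>z i\<bar>)"
      by (simp add: power_one_over field_simps)
    then show "1 \<le> (2 :: real) ^ B * (\<Prod>i<m. (1 / 2) ^ nat \<bar>z i\<bar>)"
      by (simp only: power_sum)
  qed
  also have "\<dots> \<le> (\<Sum>z\<in>{..<m} \<rightarrow>\<^sub>E {- int B..int B}. 2 ^ B * (\<Prod>i<m. (1 / 2) ^ nat \<bar>z i\<bar>))"
  proof (rule sum_mono2[OF _ l1_ball_subset])
    show "finite ({..<m} \<rightarrow>\<^sub>E {- int B..int B})"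
      by (intro finite_PiE) simp_all
  qed (intro mult_nonneg_nonneg prod_nonneg; simp)
  also have "\<dots> = 2 ^ B * (\<Prod>i<m. \<Sum>y = - int B..int B. (1 / 2) ^ nat \<bar>y\<bar>)"
    by (subst prod_sum_PiE) (simp_all add: sum_distrib_left)
  also have "\<dots> \<le> 2 ^ B * (\<Prod>i<m. 3)"
    by (intro mult_left_mono prod_mono conjI sum_nonneg sum_half_power_abs) simp_all
  finally show ?thesis
    by (simp add: mult.commute)
qed

section \<open>Numerical estimates for the Laplace transform and the union bound\<close>

lemma exp_minus_le_quadratic:
  fixes x :: real
  assumes "0 \<le> x"
  shows "exp (- x) \<le> 1 - x + x\<^sup>2 / 2"
proof -
  have "1 - 0 + 0\<^sup>2 / 2 - exp (- 0 :: real) \<le> 1 - x + x\<^sup>2 / 2 - exp (- x)"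
  proof (rule DERIV_nonneg_imp_nondecreasing[OF assms])
    fix y :: real
    have "((\<lambda>x. 1 - x + x\<^sup>2 / 2 - exp (- x)) has_real_derivative (- 1 + y + exp (- y))) (at y)"
      by (auto intro!: derivative_eq_intros)
    moreover have "0 \<le> - 1 + y + exp (- y)"
      using exp_ge_add_one_self[of "- y"] by simp
    ultimately show "\<exists>D. ((\<lambda>x. 1 - x + x\<^sup>2 / 2 - exp (- x)) has_real_derivative D) (at y) \<and> 0 \<le> D"
      by blast
  qed
  then show ?thesis
    by simp
qed

text \<open>The factor before the exponential bounds the number of grid points in dimension
  \<open>m = 2 * r\<close> with radius \<open>8 * m\<close>, and \<open>exp (- 20 * real r)\<close>
  is the failure probability allowed at each. The base is \<open>9 * 2 ^ 16 = 589824\<close>, and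
  \<open>exp 20 \<ge> (5 / 2) ^ 20\<close> exceeds 40 times that.\<close>

lemma grid_union_bound:
  assumes "1 \<le> r"
  shows "3 ^ (2 * r) * 2 ^ (8 * (2 * r)) * exp (- 20 * real r) \<le> (1 / 40 :: real)"
proof -
  have "(5 / 2) ^ 20 \<le> exp (1 :: real) ^ 20"
    using exp_lower_Taylor_quadratic[of 1] by (intro power_mono) auto
  also have "exp (1 :: real) ^ 20 = exp 20"
    using exp_of_nat_mult[of 20 "1 :: real"] by simp
  finally have "23592960 \<le> exp (20 :: real)"
    by (rule order_trans[rotated]) (simp add: power_divide)
  then have e: "589824 * exp (- 20) \<le> (1 / 40 :: real)"
    by (simp add: exp_minus field_simps)
  have "(3 :: real) ^ (2 * r) * 2 ^ (8 * (2 * r)) * exp (- 20 * real r)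
      = (3\<^sup>2) ^ r * (2 ^ 16) ^ r * exp (- 20) ^ r"
    by (simp only: power_mult[symmetric] exp_of_nat2_mult[symmetric]) simp
  also have "\<dots> = (589824 * exp (- 20)) ^ r"
    by (simp only: power_mult_distrib[symmetric]) simp
  also have "\<dots> \<le> (1 / 40) ^ r"
    using e by (intro power_mono) auto
  also have "\<dots> \<le> (1 / 40) ^ 1"
    using assms by (intro power_decreasing) auto
  finally show ?thesis
    by simp
qed

section \<open>Moments of Kronecker products\<close>

text \<open>Entry \<open>p\<close> of the Kronecker product of the factors listed in
  \<open>js\<close>, read off from the base-\<open>d\<close> digits of \<open>p\<close> with the
  leading digit first. Selecting the factors by a list of indices lets one column be a sublist of
  all coordinates of the product space.\<close>

primrec kron_coeff :: "nat \<Rightarrow> 'i list \<Rightarrow> ('i \<Rightarrow> 'a :: comm_ring_1 vec) \<Rightarrow> nat \<Rightarrow> 'a" where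
  "kron_coeff d [] w p = 1"
| "kron_coeff d (i # js) w p =
     w i $ (p div d ^ length js) * kron_coeff d js w (p mod d ^ length js)"

lemma kron_list_map:
  assumes "\<And>i. i \<in> set js \<Longrightarrow> dim_vec (w i) = d" "0 < d"
  shows "kron_list (map w js) = vec (d ^ length js) (kron_coeff d js w)"
  using assms
proof (induction js)
  case Nil
  then show ?case
    by (simp add: kron_list_def)
next
  case (Cons i js)
  have "kron_list (map w (i # js)) = w i \<otimes>\<^sub>v kron_list (map w js)"
    by (simp add: kron_list_def)
  then show ?case
    using Cons by (auto simp: kron_vec_def)
qed

lemma kron_coeff_cong:
  "(\<And>i. i \<in> set js \<Longrightarrow> w i = w' i) \<Longrightarrow> kron_coeff d js w p = kron_coeff d js w' p"
  by (induction js arbitrary: p) auto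

text \<open>The inner product of the Kronecker product with \<open>x\<close>, conjugate linear in
  the former. A plain function \<open>x\<close> makes it easy to pass to the slices
  \<open>x (a * d ^ n + b)\<close>.\<close>

definition kron_inner ::
  "nat \<Rightarrow> 'i list \<Rightarrow> (nat \<Rightarrow> 'a) \<Rightarrow> ('i \<Rightarrow> 'a :: conjugatable_field vec) \<Rightarrow> 'a" where
  "kron_inner d js x w = (\<Sum>p<d ^ length js. x p * conjugate (kron_coeff d js w p))"

lemma kron_inner_cong:
  "(\<And>i. i \<in> set js \<Longrightarrow> w i = w' i) \<Longrightarrow> kron_inner d js x w = kron_inner d js x w'"
  by (simp add: kron_inner_def cong: kron_coeff_cong)

lemma sum_lessThan_power_Suc:
  "(\<Sum>p<d ^ Suc n. f p) = (\<Sum>a<d. \<Sum>b<d ^ n. f (a * d ^ n + b))"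
  for f :: "nat \<Rightarrow> 'b :: comm_monoid_add"
proof -
  have "(\<Sum>p<d ^ Suc n. f p) = (\<Sum>a<d. sum f {a * d ^ n..<a * d ^ n + d ^ n})"
    by (simp add: sum.nat_group)
  also have "\<dots> = (\<Sum>a<d. \<Sum>b<d ^ n. f (a * d ^ n + b))"
  proof (rule sum.cong[OF refl])
    fix a
    show "sum f {a * d ^ n..<a * d ^ n + d ^ n} = (\<Sum>b<d ^ n. f (a * d ^ n + b))"
      using sum.shift_bounds_nat_ivl[of f 0 "a * d ^ n" "d ^ n"]
      by (simp add: atLeast0LessThan add.commute)
  qed
  finally show ?thesis .
qed

text \<open>Splitting off the leading digit exhibits a linear form in the factor \<open>w i\<close>,
  whose coefficients involve only the factors in \<open>js\<close>. This is what allows conditioning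
  on all factors but one.\<close>

lemma kron_inner_Cons:
  "kron_inner d (i # js) x w
    = (\<Sum>a<d. kron_inner d js (\<lambda>b. x (a * d ^ length js + b)) w * conjugate (w i $ a))"
proof -
  have "x (a * d ^ length js + b) * conjugate (kron_coeff d (i # js) w (a * d ^ length js + b))
      = x (a * d ^ length js + b) * conjugate (kron_coeff d js w b) * conjugate (w i $ a)"
    if "b < d ^ length js" for a b
  proof -
    have "d ^ length js \<noteq> 0"
      using that by linarith
    then have "(a * d ^ length js + b) div d ^ length js = a"
      using that by (subst div_mult_self3) auto
    then show ?thesis
      using that by (simp add: conjugate_dist_mul mult.assoc mult.left_commute mult.commute)
  qed
  then show ?thesis
    by (simp only: kron_inner_def list.size add_Suc_right add_0_right sum_lessThan_power_Suc
        sum_distrib_right)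
      (auto intro!: sum.cong)
qed

lemma ennreal_power2_leD:
  assumes "x\<^sup>2 \<le> ennreal (t\<^sup>2)" "0 \<le> t"
  shows "x \<le> ennreal t"
  using assms by (cases x) (auto simp: ennreal_power power2_le_iff_abs_le top_unique ennreal_top_mult)

text \<open>Cauchy-Schwarz for the squares \<open>f\<^sup>2\<close> and \<open>g\<^sup>2\<close>, in
  the form needed for the mixed terms of a tensorized fourth moment. Nonnegative integrals avoid
  integrability conditions inside the induction.\<close>

lemma nn_integral_mult_square_le:
  fixes f g :: "'w \<Rightarrow> real"
  assumes [measurable]: "f \<in> borel_measurable M" "g \<in> borel_measurable M"
    and f: "(\<integral>\<^sup>+w. ennreal (f w ^ 4) \<partial>M) \<le> ennreal (c * a\<^sup>2)"
    and g: "(\<integral>\<^sup>+w. ennreal (g w ^ 4) \<partial>M) \<le> ennreal (c * b\<^sup>2)"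
    and nonneg: "0 \<le> a" "0 \<le> b" "0 \<le> c"
  shows "(\<integral>\<^sup>+w. ennreal ((f w)\<^sup>2 * (g w)\<^sup>2) \<partial>M) \<le> ennreal (c * (a * b))"
proof (rule ennreal_power2_leD)
  have "(\<integral>\<^sup>+w. ennreal ((f w)\<^sup>2 * (g w)\<^sup>2) \<partial>M)\<^sup>2
      = (\<integral>\<^sup>+w. ennreal ((f w)\<^sup>2) * ennreal ((g w)\<^sup>2) \<partial>M)\<^sup>2"
    by (simp add: ennreal_mult)
  also have "\<dots> \<le> (\<integral>\<^sup>+w. (ennreal ((f w)\<^sup>2))\<^sup>2 \<partial>M) * (\<integral>\<^sup>+w. (ennreal ((g w)\<^sup>2))\<^sup>2 \<partial>M)"
    by (rule Cauchy_Schwarz_nn_integral) auto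
  also have "\<dots> = (\<integral>\<^sup>+w. ennreal (f w ^ 4) \<partial>M) * (\<integral>\<^sup>+w. ennreal (g w ^ 4) \<partial>M)"
    by (simp add: ennreal_power)
  also have "\<dots> \<le> ennreal (c * a\<^sup>2) * ennreal (c * b\<^sup>2)"
    by (rule mult_mono[OF f g]) auto
  also have "\<dots> = ennreal ((c * (a * b))\<^sup>2)"
    using nonneg by (simp add: ennreal_mult[symmetric] power2_eq_square algebra_simps)
  finally show "(\<integral>\<^sup>+w. ennreal ((f w)\<^sup>2 * (g w)\<^sup>2) \<partial>M)\<^sup>2 \<le> ennreal ((c * (a * b))\<^sup>2)" .
qed (use nonneg in auto)

lemma sum_sum_mult_eq:
  "(\<Sum>a\<in>A. \<Sum>b\<in>A. c * (f a * f b)) = c * (\<Sum>a\<in>A. f a)\<^sup>2"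
  for f :: "'b \<Rightarrow> 'c :: comm_semiring_1"
  unfolding power2_eq_square sum_product by (simp add: sum_distrib_left)

section \<open>Moments of linear forms and of Kronecker products under the base distribution\<close>

locale base_distribution =
  fixes d :: nat and N :: "'a :: real_or_complex vec measure" and C :: real
  assumes dist: "vec_distribution d N"
    and iso: "isotropic d N"
    and fourth: "fourth_moment_bound d N C"
    and d_pos: "1 \<le> d"
begin

sublocale prob_space N
  using dist by (simp add: vec_distribution_def)

lemma space_N: "space N = carrier_vec d"
proof -
  have "space N = space (vec_borel d :: 'a vec measure)"
    using dist sets_eq_imp_space_eq unfolding vec_distribution_def by blast
  then show ?thesis
    by (simp add: vec_borel_def)
qed

lemma component_measurable [measurable]:
  assumes "i < d"
  shows "(\<lambda>v. v $ i) \<in> borel_measurable N"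
proof -
  have "(\<lambda>v. \<lambda>i\<in>{..<d}. v $ i) \<in> vec_borel d \<rightarrow>\<^sub>M (\<Pi>\<^sub>M i\<in>{..<d}. (borel :: 'a measure))"
    unfolding vec_borel_def by (rule measurable_vimage_algebra1) (auto simp: space_PiM)
  then have "(\<lambda>v. (\<lambda>i\<in>{..<d}. v $ i) i) \<in> vec_borel d \<rightarrow>\<^sub>M (borel :: 'a measure)"
    by (rule measurable_compose) (use assms in \<open>auto intro: measurable_component_singleton\<close>)
  then have "(\<lambda>v. v $ i) \<in> vec_borel d \<rightarrow>\<^sub>M (borel :: 'a measure)"
    using assms by simp
  then show ?thesis
    using dist by (subst measurable_cong_sets[of _ "vec_borel d" _ borel])
      (auto simp: vec_distribution_def)
qed

lemma kron_coeff_measurable: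
  fixes js :: "'i list"
  assumes "set js \<subseteq> I" "p < d ^ length js"
  shows "(\<lambda>w. kron_coeff d js w p) \<in> borel_measurable (\<Pi>\<^sub>M i\<in>I. N)"
  using assms
proof (induction js arbitrary: p)
  case (Cons i js)
  have "p div d ^ length js < d"
    using Cons.prems(2) by (simp add: less_mult_imp_div_less)
  then have "(\<lambda>w. w i $ (p div d ^ length js)) \<in> borel_measurable (\<Pi>\<^sub>M i\<in>I. N)"
    using Cons.prems(1) by (intro measurable_compose[OF measurable_component_singleton]) auto
  moreover have "p mod d ^ length js < d ^ length js"
    using d_pos by (intro mod_less_divisor) auto
  ultimately show ?case
    using Cons by (auto intro!: borel_measurable_times)
qed simp

lemma kron_inner_measurable:
  fixes js :: "'i list"
  shows "set js \<subseteq> I \<Longrightarrow> kron_inner d js x \<in> borel_measurable (\<Pi>\<^sub>M i\<in>I. N)"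
  unfolding kron_inner_def[abs_def]
  by (intro borel_measurable_sum borel_measurable_times borel_measurable_const
      measurable_compose[OF _ borel_measurable_conjugate] kron_coeff_measurable) auto

lemma linear_form_measurable [measurable]:
  "(\<lambda>v. \<Sum>a<d. g a * conjugate (v $ a)) \<in> borel_measurable N"
  by (intro borel_measurable_sum borel_measurable_times borel_measurable_const
      measurable_compose[OF _ borel_measurable_conjugate] component_measurable) auto

text \<open>Expanding the square gives a double sum against the covariance matrix, which isotropy
  makes the identity.\<close>

lemma second_moment_linear_form:
  "(\<integral>\<^sup>+v. ennreal ((norm (\<Sum>a<d. g a * conjugate (v $ a)))\<^sup>2) \<partial>N)
    = ennreal (\<Sum>a<d. (norm (g a))\<^sup>2)"
proof -
  have int: "integrable N (\<lambda>v. v $ i * conjugate (v $ j))" if "i < d" "j < d" for i j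
    using iso that by (simp add: isotropic_def)
  have cov: "(\<integral>v. v $ i * conjugate (v $ j) \<partial>N) = (if i = j then 1 else 0)"
    if "i < d" "j < d" for i j
  proof -
    have "mat d d (\<lambda>(i, j). \<integral>v. v $ i * conjugate (v $ j) \<partial>N) $$ (i, j) = 1\<^sub>m d $$ (i, j)"
      using iso by (simp add: isotropic_def)
    then show ?thesis
      using that by simp
  qed
  have expand: "(of_real ((norm (\<Sum>a<d. g a * conjugate (v $ a)))\<^sup>2) :: 'a)
      = (\<Sum>a<d. \<Sum>b<d. g a * conjugate (g b) * (v $ b * conjugate (v $ a)))" for v
    by (simp add: of_real_norm_square sum_conjugate conjugate_dist_mul sum_product
        mult.commute mult.left_commute mult.assoc del: of_real_power)
  \<comment> \<open>\<open>isotropic\<close> gives integrability of products of entries, hence of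
    the scalar-valued expansion; taking norms then recovers the real square.\<close>
  have int_of_real: "integrable N (\<lambda>v. of_real ((norm (\<Sum>a<d. g a * conjugate (v $ a)))\<^sup>2) :: 'a)"
    unfolding expand using int by (intro Bochner_Integration.integrable_sum integrable_mult_right) auto
  have int_real: "integrable N (\<lambda>v. (norm (\<Sum>a<d. g a * conjugate (v $ a)))\<^sup>2)"
    using integrable_norm[OF int_of_real] by (simp only: norm_of_real abs_power2)
  have "(of_real (\<integral>v. (norm (\<Sum>a<d. g a * conjugate (v $ a)))\<^sup>2 \<partial>N) :: 'a)
      = (\<integral>v. of_real ((norm (\<Sum>a<d. g a * conjugate (v $ a)))\<^sup>2) \<partial>N)"
    using int_real by (simp only: integral_of_real)
  also have "\<dots> = (\<Sum>a<d. \<Sum>b<d. g a * conjugate (g b) * (\<integral>v. v $ b * conjugate (v $ a) \<partial>N))"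
  proof -
    have "integrable N (\<lambda>v. g a * conjugate (g b) * (v $ b * conjugate (v $ a)))"
      if "a < d" "b < d" for a b
      using int that by (intro integrable_mult_right) auto
    then show ?thesis
      unfolding expand
      by (subst Bochner_Integration.integral_sum; auto intro!: Bochner_Integration.integrable_sum
          sum.cong simp: Bochner_Integration.integral_sum)
  qed
  also have "\<dots> = (\<Sum>a<d. g a * conjugate (g a))"
  proof (rule sum.cong[OF refl])
    fix a
    assume a: "a \<in> {..<d}"
    have "(\<Sum>b<d. g a * conjugate (g b) * (\<integral>v. v $ b * conjugate (v $ a) \<partial>N))
        = (\<Sum>b<d. if b = a then g a * conjugate (g a) else 0)"
      using a cov by (intro sum.cong) auto
    then show "(\<Sum>b<d. g a * conjugate (g b) * (\<integral>v. v $ b * conjugate (v $ a) \<partial>N))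
        = g a * conjugate (g a)"
      using a by simp
  qed
  also have "\<dots> = of_real (\<Sum>a<d. (norm (g a))\<^sup>2)"
    by (simp add: of_real_norm_square del: of_real_power)
  finally have "(\<integral>v. (norm (\<Sum>a<d. g a * conjugate (v $ a)))\<^sup>2 \<partial>N) = (\<Sum>a<d. (norm (g a))\<^sup>2)"
    by (simp only: of_real_eq_iff)
  then show ?thesis
    using int_real by (subst nn_integral_eq_integral) auto
qed

text \<open>By homogeneity: the assumed bound for unit vectors is applied to the normalized
  coefficients \<open>u\<close>, and the scaling returns as \<open>s ^ 4\<close>. Zero coefficients
  cannot be normalized and are treated first.\<close>

lemma fourth_moment_linear_form:
  "(\<integral>\<^sup>+v. ennreal (norm (\<Sum>a<d. g a * conjugate (v $ a)) ^ 4) \<partial>N)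
    \<le> ennreal (C * (\<Sum>a<d. (norm (g a))\<^sup>2)\<^sup>2)"
proof (cases "(\<Sum>a<d. (norm (g a))\<^sup>2) = 0")
  case True
  then have "\<And>a. a < d \<Longrightarrow> g a = 0"
    by (simp add: sum_nonneg_eq_0_iff)
  then show ?thesis
    by simp
next
  case False
  define s where "s = sqrt (\<Sum>a<d. (norm (g a))\<^sup>2)"
  have s: "0 < s"
    using False by (simp add: s_def sum_nonneg order.not_eq_order_implies_strict)
  have s2: "s\<^sup>2 = (\<Sum>a<d. (norm (g a))\<^sup>2)"
    by (simp add: s_def sum_nonneg)
  define u where "u = vec d (\<lambda>a. g a / of_real s)"
  have "(\<Sum>a<d. (norm (g a / of_real s))\<^sup>2) = 1"
    using s by (simp add: norm_divide power_divide sum_divide_distrib[symmetric] s2[symmetric])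
  then have "u \<in> carrier_vec d" "l2_norm u = 1"
    by (simp_all add: u_def l2_norm_def)
  then have int: "integrable N (\<lambda>v. norm (u \<bullet>c v) ^ 4)"
    and le: "(\<integral>v. norm (u \<bullet>c v) ^ 4 \<partial>N) \<le> C"
    using fourth by (auto simp: fourth_moment_bound_def)
  have form: "norm (\<Sum>a<d. g a * conjugate (v $ a)) ^ 4 = s ^ 4 * norm (u \<bullet>c v) ^ 4"
    if "v \<in> space N" for v
  proof -
    have v: "dim_vec v = d"
      using that by (simp add: space_N)
    have "of_real s * (u \<bullet>c v) = (\<Sum>a<d. g a * conjugate (v $ a))"
      using s v by (auto simp: u_def scalar_prod_def atLeast0LessThan sum_distrib_left intro!: sum.cong)
    then have "norm (\<Sum>a<d. g a * conjugate (v $ a)) = s * norm (u \<bullet>c v)"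
      using s by (metis norm_mult norm_of_real abs_of_pos)
    then show ?thesis
      by (simp add: power_mult_distrib)
  qed
  have "(\<integral>\<^sup>+v. ennreal (norm (\<Sum>a<d. g a * conjugate (v $ a)) ^ 4) \<partial>N)
      = (\<integral>\<^sup>+v. ennreal (s ^ 4 * norm (u \<bullet>c v) ^ 4) \<partial>N)"
    by (rule nn_integral_cong) (simp add: form)
  also have "\<dots> = ennreal (\<integral>v. s ^ 4 * norm (u \<bullet>c v) ^ 4 \<partial>N)"
    using int by (intro nn_integral_eq_integral) auto
  also have "\<dots> = ennreal (s ^ 4 * (\<integral>v. norm (u \<bullet>c v) ^ 4 \<partial>N))"
    by simp
  also have "\<dots> \<le> ennreal (s ^ 4 * C)"
    using le by (intro ennreal_leI mult_left_mono) auto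
  also have "s ^ 4 * C = C * (\<Sum>a<d. (norm (g a))\<^sup>2)\<^sup>2"
    by (simp add: s2[symmetric])
  finally show ?thesis .
qed

text \<open>Induction on the factors: integrating out the first one by isotropy leaves the sum of
  the squared slices. The index set \<open>I\<close> may exceed \<open>js\<close>, so the result
  applies to one column inside the space of all factors.\<close>

lemma kron_inner_second_moment:
  fixes js :: "'i list"
  assumes "finite I" "set js \<subseteq> I" "distinct js"
  shows "(\<integral>\<^sup>+w. ennreal ((norm (kron_inner d js x w))\<^sup>2) \<partial>(\<Pi>\<^sub>M i\<in>I. N))
    = ennreal (\<Sum>p<d ^ length js. (norm (x p))\<^sup>2)"
  using assms
proof (induction js arbitrary: I x)
  case Nil
  interpret PI: prob_space "\<Pi>\<^sub>M i\<in>I. N"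
    by (rule prob_space_PiM) unfold_locales
  show ?case
    by (simp add: kron_inner_def PI.emeasure_space_1)
next
  case (Cons i js)
  interpret P: product_prob_space "\<lambda>_ :: 'i. N"
    ..
  define J where "J = I - {i}"
  have J: "finite J" "i \<notin> J" "I = insert i J" "set js \<subseteq> J" "i \<notin> set js"
    using Cons.prems by (auto simp: J_def)
  let ?g = "\<lambda>a. kron_inner d js (\<lambda>b. x (a * d ^ length js + b))"
  have meas [measurable]: "?g a \<in> borel_measurable (\<Pi>\<^sub>M i\<in>J. N)" for a
    by (rule kron_inner_measurable[OF J(4)])
  have [measurable]: "kron_inner d (i # js) x \<in> borel_measurable (\<Pi>\<^sub>M i\<in>insert i J. N)"
    using J by (intro kron_inner_measurable) auto
  have meas': "(\<lambda>w. ennreal ((norm (kron_inner d (i # js) x w))\<^sup>2))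
      \<in> borel_measurable (\<Pi>\<^sub>M i\<in>insert i J. N)"
    by measurable
  have upd: "kron_inner d (i # js) x (w(i := y)) = (\<Sum>a<d. ?g a w * conjugate (y $ a))" for w y
    unfolding kron_inner_Cons using J(5) by (auto intro!: sum.cong kron_inner_cong)
  have "(\<integral>\<^sup>+w. ennreal ((norm (kron_inner d (i # js) x w))\<^sup>2) \<partial>(\<Pi>\<^sub>M i\<in>I. N))
      = (\<integral>\<^sup>+w. (\<integral>\<^sup>+y. ennreal ((norm (\<Sum>a<d. ?g a w * conjugate (y $ a)))\<^sup>2) \<partial>N) \<partial>(\<Pi>\<^sub>M i\<in>J. N))"
    unfolding J(3) upd[symmetric] by (rule P.product_nn_integral_insert[OF J(1,2) meas'])
  also have "\<dots> = (\<integral>\<^sup>+w. (\<Sum>a<d. ennreal ((norm (?g a w))\<^sup>2)) \<partial>(\<Pi>\<^sub>M i\<in>J. N))"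
    by (simp add: second_moment_linear_form sum_ennreal)
  also have "\<dots> = (\<Sum>a<d. \<integral>\<^sup>+w. ennreal ((norm (?g a w))\<^sup>2) \<partial>(\<Pi>\<^sub>M i\<in>J. N))"
    by (rule nn_integral_sum) measurable
  also have "\<dots> = (\<Sum>a<d. ennreal (\<Sum>b<d ^ length js. (norm (x (a * d ^ length js + b)))\<^sup>2))"
    using Cons.IH[OF J(1,4)] Cons.prems by simp
  also have "\<dots> = ennreal (\<Sum>p<d ^ length (i # js). (norm (x p))\<^sup>2)"
    by (simp only: list.size add_Suc_right add_0_right sum_lessThan_power_Suc sum_ennreal
        sum_nonneg zero_le_power2)
  finally show ?case .
qed

text \<open>For the first coordinate of the random vector, isotropy and Cauchy-Schwarz give
  \<open>1 = (E |v 0|^2)^2 \<le> E |v 0|^4 \<le> C\<close>. Thus \<open>C ^ l \<ge> 1\<close>, which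
  later yields \<open>r \<le> k\<close> and absorbs the rounding of \<open>k\<close> to an
  integer.\<close>

lemma C_ge_1: "1 \<le> C"
proof -
  let ?g = "\<lambda>a::nat. if a = 0 then (1::'a) else 0"
  let ?f = "\<lambda>v. norm (\<Sum>a<d. ?g a * conjugate (v $ a))"
  have one: "(\<Sum>a<d. (norm (?g a))\<^sup>2) = 1"
  proof -
    have "(\<Sum>a<d. (norm (?g a))\<^sup>2) = (\<Sum>a<d. if a = 0 then 1 else 0)"
      by (rule sum.cong) auto
    then show ?thesis
      using d_pos by simp
  qed
  have "1 = (\<integral>\<^sup>+v. ennreal ((?f v)\<^sup>2) * 1 \<partial>N)\<^sup>2"
    using second_moment_linear_form[of ?g] unfolding one by simp
  also have "\<dots> \<le> (\<integral>\<^sup>+v. (ennreal ((?f v)\<^sup>2))\<^sup>2 \<partial>N) * (\<integral>\<^sup>+v. 1\<^sup>2 \<partial>N)"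
    by (rule Cauchy_Schwarz_nn_integral) measurable
  also have "\<dots> = (\<integral>\<^sup>+v. ennreal (?f v ^ 4) \<partial>N)"
    by (simp add: ennreal_power emeasure_space_1)
  also have "\<dots> \<le> ennreal C"
    using fourth_moment_linear_form[of ?g] unfolding one by simp
  finally show ?thesis
    by (metis ennreal_1 ennreal_le_iff2 not_one_le_zero)
qed

text \<open>The induction of the second moment again, where each factor now costs one
  \<open>C\<close>.\<close>

lemma kron_inner_fourth_moment:
  fixes js :: "'i list"
  assumes "finite I" "set js \<subseteq> I" "distinct js"
  shows "(\<integral>\<^sup>+w. ennreal (norm (kron_inner d js x w) ^ 4) \<partial>(\<Pi>\<^sub>M i\<in>I. N))
    \<le> ennreal (C ^ length js * (\<Sum>p<d ^ length js. (norm (x p))\<^sup>2)\<^sup>2)"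
  using assms
proof (induction js arbitrary: I x)
  case Nil
  interpret PI: prob_space "\<Pi>\<^sub>M i\<in>I. N"
    by (rule prob_space_PiM) unfold_locales
  show ?case
    by (simp add: kron_inner_def PI.emeasure_space_1)
next
  case (Cons i js)
  interpret P: product_prob_space "\<lambda>_ :: 'i. N"
    ..
  define J where "J = I - {i}"
  have J: "finite J" "i \<notin> J" "I = insert i J" "set js \<subseteq> J" "i \<notin> set js"
    using Cons.prems by (auto simp: J_def)
  let ?g = "\<lambda>a. kron_inner d js (\<lambda>b. x (a * d ^ length js + b))"
  let ?X = "\<lambda>a. \<Sum>b<d ^ length js. (norm (x (a * d ^ length js + b)))\<^sup>2"
  have C: "0 \<le> C"
    using C_ge_1 by simp
  have meas [measurable]: "?g a \<in> borel_measurable (\<Pi>\<^sub>M i\<in>J. N)" for a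
    by (rule kron_inner_measurable[OF J(4)])
  have [measurable]: "kron_inner d (i # js) x \<in> borel_measurable (\<Pi>\<^sub>M i\<in>insert i J. N)"
    using J by (intro kron_inner_measurable) auto
  have meas': "(\<lambda>w. ennreal (norm (kron_inner d (i # js) x w) ^ 4))
      \<in> borel_measurable (\<Pi>\<^sub>M i\<in>insert i J. N)"
    by measurable
  have upd: "kron_inner d (i # js) x (w(i := y)) = (\<Sum>a<d. ?g a w * conjugate (y $ a))" for w y
    unfolding kron_inner_Cons using J(5) by (auto intro!: sum.cong kron_inner_cong)
  have "(\<integral>\<^sup>+w. ennreal (norm (kron_inner d (i # js) x w) ^ 4) \<partial>(\<Pi>\<^sub>M i\<in>I. N))
      = (\<integral>\<^sup>+w. (\<integral>\<^sup>+y. ennreal (norm (\<Sum>a<d. ?g a w * conjugate (y $ a)) ^ 4) \<partial>N) \<partial>(\<Pi>\<^sub>M i\<in>J. N))"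
    unfolding J(3) upd[symmetric] by (rule P.product_nn_integral_insert[OF J(1,2) meas'])
  also have "\<dots> \<le> (\<integral>\<^sup>+w. ennreal (C * (\<Sum>a<d. (norm (?g a w))\<^sup>2)\<^sup>2) \<partial>(\<Pi>\<^sub>M i\<in>J. N))"
    by (intro nn_integral_mono fourth_moment_linear_form)
  \<comment> \<open>The square is opened into pairs of slices: Cauchy-Schwarz bounds each mixed
    moment through the induction hypothesis for its two slices, and the resulting product bounds sum
    up to a square again.\<close>
  also have "\<dots> = (\<integral>\<^sup>+w. ennreal C *
      (\<Sum>a<d. \<Sum>b<d. ennreal ((norm (?g a w))\<^sup>2 * (norm (?g b w))\<^sup>2)) \<partial>(\<Pi>\<^sub>M i\<in>J. N))"
    using C by (intro nn_integral_cong)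
      (simp add: ennreal_mult' sum_nonneg power2_eq_square[of "sum _ _"] sum_product
        sum_ennreal[symmetric] del: sum_ennreal)
  also have "\<dots> = ennreal C *
      (\<Sum>a<d. \<Sum>b<d. \<integral>\<^sup>+w. ennreal ((norm (?g a w))\<^sup>2 * (norm (?g b w))\<^sup>2) \<partial>(\<Pi>\<^sub>M i\<in>J. N))"
    by (simp add: nn_integral_cmult nn_integral_sum del: sum_ennreal)
  also have "\<dots> \<le> ennreal C * (\<Sum>a<d. \<Sum>b<d. ennreal (C ^ length js * (?X a * ?X b)))"
    using Cons.IH[OF J(1,4)] Cons.prems C
    by (intro mult_left_mono sum_mono nn_integral_mult_square_le) (auto intro!: sum_nonneg)
  also have "\<dots> = ennreal (C * (\<Sum>a<d. \<Sum>b<d. C ^ length js * (?X a * ?X b)))"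
  proof -
    have "0 \<le> C ^ length js * (?X a * ?X b)" for a b
      using C by (intro mult_nonneg_nonneg sum_nonneg) auto
    then show ?thesis
      using C by (simp only: sum_ennreal sum_nonneg ennreal_mult'')
  qed
  also have "(\<Sum>a<d. \<Sum>b<d. C ^ length js * (?X a * ?X b)) = C ^ length js * (\<Sum>a<d. ?X a)\<^sup>2"
    by (rule sum_sum_mult_eq)
  also have "C * (C ^ length js * (\<Sum>a<d. ?X a)\<^sup>2)
      = C ^ length (i # js) * (\<Sum>p<d ^ length (i # js). (norm (x p))\<^sup>2)\<^sup>2"
    by (simp only: list.size add_Suc_right add_0_right sum_lessThan_power_Suc power_Suc2[of C] mult.assoc mult.left_commute)
  finally show ?case .
qed

end

section \<open>Orthonormal bases of subspaces\<close>

lemma l2_norm_square: "(l2_norm x)\<^sup>2 = (\<Sum>p<dim_vec x. (norm (x $ p))\<^sup>2)"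
  by (simp add: l2_norm_def sum_nonneg)

text \<open>Independent subsets of \<open>V\<close> are no larger than the ambient dimension, so a
  maximal one exists. It is a basis of \<open>V\<close>, as independence in \<open>V\<close> and in
  the whole space agree, and Gram-Schmidt makes it orthogonal without changing the span.\<close>

lemma subspace_of_dim_orthogonal_basis:
  fixes V :: "'a :: conjugatable_ordered_field vec set"
  assumes V: "subspace_of_dim n r V"
  obtains us where "set us \<subseteq> carrier_vec n" "length us = r" "corthogonal us"
    "V = LinearCombinations.module.span class_ring (module_vec TYPE('a) n) (set us)"
proof -
  interpret cof_vec_space n "TYPE('a)" .
  have sub: "VectorSpace.subspace class_ring V (module_vec TYPE('a) n)"
    and dimV: "vectorspace.dim class_ring (vs V) = r"
    using V by (auto simp: subspace_of_dim_def)
  have submod: "submodule class_ring V (module_vec TYPE('a) n)"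
    using sub by (simp add: subspace_def)
  have Vcarr: "V \<subseteq> carrier_vec n"
    using submod by (simp add: submodule_def)
  interpret W: vectorspace class_ring "vs V"
    by (rule subspace_is_vs[OF sub])
  have indep_eq: "W.lin_dep S = lin_dep S" if "S \<subseteq> V" for S
    by (rule span_li_not_depend(2)[OF that submod])
  have "\<exists>A. finite A \<and> maximal A (\<lambda>S. S \<subseteq> V \<and> lin_indpt S)"
  proof (rule maximal_exists[where N = "dim"])
    show "finite A \<and> card A \<le> dim" if "A \<subseteq> V \<and> lin_indpt A" for A
      using that Vcarr li_le_dim[OF fin_dim, of A] by auto
    show "{} \<subseteq> V \<and> lin_indpt {}"
      by (auto simp: lin_dep_def)
  qed
  then obtain A where A: "finite A" "maximal A (\<lambda>S. S \<subseteq> V \<and> lin_indpt S)"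
    by blast
  then have AV: "A \<subseteq> V" "lin_indpt A"
    by (auto simp: maximal_def)
  have "maximal A (\<lambda>S. S \<subseteq> carrier (vs V) \<and> W.lin_indpt S)"
    using A(2) indep_eq unfolding maximal_def by auto
  then have basis: "W.basis A"
    by (rule W.max_li_is_basis)
  then have "card A = r"
    using W.dim_basis[OF A(1)] dimV by simp
  have spanA: "span A = V"
    using basis span_li_not_depend(1)[OF AV(1) submod] by (simp add: W.basis_def)
  obtain ws where ws: "set ws = A" "distinct ws"
    using finite_distinct_list[OF A(1)] by blast
  have len: "length ws = r"
    using ws \<open>card A = r\<close> distinct_card by metis
  have "set ws \<subseteq> carrier_vec n"
    using AV Vcarr ws by auto
  moreover have "lin_indpt (set ws)"
    using AV ws by simp
  ultimately show ?thesis
    using gram_schmidt_result[OF _ ws(2) _ refl] that[of "gram_schmidt n ws"] len spanA ws by simp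
qed

text \<open>Passes from linear combinations over a set of vectors to coefficients indexed by list
  position, which suits coordinates and finite sums.\<close>

lemma span_set_list_iff:
  fixes us :: "'a :: field vec list"
  assumes "set us \<subseteq> carrier_vec n" "distinct us"
  shows "x \<in> LinearCombinations.module.span class_ring (module_vec TYPE('a) n) (set us)
    \<longleftrightarrow> x \<in> carrier_vec n \<and> (\<exists>c. \<forall>p<n. x $ p = (\<Sum>i<length us. c i * us ! i $ p))"
proof -
  interpret vec_space "TYPE('a)" n .
  have idx: "lincomb c (set us) $ p = (\<Sum>i<length us. c (us ! i) * us ! i $ p)" if "p < n" for c p
    using assms that
    by (simp add: lincomb_index sum.distinct_set_conv_list sum_list_sum_nth atLeast0LessThan)
  show ?thesis
  proof
    assume x: "x \<in> span (set us)"
    then obtain c where c: "x = lincomb c (set us)"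
      using finite_in_span[OF _ assms(1)] by auto
    have "x \<in> carrier_vec n"
      using x assms(1) span_is_subset2 by auto
    then show "x \<in> carrier_vec n \<and> (\<exists>c. \<forall>p<n. x $ p = (\<Sum>i<length us. c i * us ! i $ p))"
      using idx c by auto
  next
    assume "x \<in> carrier_vec n \<and> (\<exists>c. \<forall>p<n. x $ p = (\<Sum>i<length us. c i * us ! i $ p))"
    then obtain c where x: "x \<in> carrier_vec n"
      and c: "\<And>p. p < n \<Longrightarrow> x $ p = (\<Sum>i<length us. c i * us ! i $ p)"
      by blast
    \<comment> \<open>Distinctness makes indexing injective, so a coefficient of a position becomes
      a coefficient of the vector found there.\<close>
    define c' where "c' = (\<lambda>u. c (inv_into {..<length us} ((!) us) u))"
    have "inj_on ((!) us) {..<length us}"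
      using assms(2) by (intro inj_on_nth) auto
    then have "c' (us ! i) = c i" if "i < length us" for i
      using that by (simp add: c'_def)
    then have "lincomb c' (set us) $ p = x $ p" if "p < n" for p
      using idx[OF that] c[OF that] by simp
    then have "x = lincomb c' (set us)"
      using x lincomb_dim[OF _ assms(1), of c'] by (intro eq_vecI) auto
    then show "x \<in> span (set us)"
      unfolding span_def by auto
  qed
qed

text \<open>Pythagoras: all cross terms of the expanded square vanish by orthogonality.\<close>

lemma norm_square_orthogonal_sum:
  fixes u :: "nat \<Rightarrow> nat \<Rightarrow> 'a :: real_or_complex"
  assumes orth: "\<And>i j. i < r \<Longrightarrow> j < r \<Longrightarrow> i \<noteq> j \<Longrightarrow> (\<Sum>p<n. u i p * conjugate (u j p)) = 0"
  shows "(\<Sum>p<n. (norm (\<Sum>i<r. c i * u i p))\<^sup>2)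
    = (\<Sum>i<r. (norm (c i))\<^sup>2 * (\<Sum>p<n. (norm (u i p))\<^sup>2))"
proof -
  have "(of_real (\<Sum>p<n. (norm (\<Sum>i<r. c i * u i p))\<^sup>2) :: 'a)
      = (\<Sum>p<n. (\<Sum>i<r. c i * u i p) * conjugate (\<Sum>i<r. c i * u i p))"
    by (simp only: of_real_sum of_real_norm_square)
  also have "\<dots> = (\<Sum>p<n. \<Sum>i<r. \<Sum>j<r. c i * conjugate (c j) * (u i p * conjugate (u j p)))"
    by (simp add: sum_conjugate conjugate_dist_mul sum_product algebra_simps)
  also have "\<dots> = (\<Sum>i<r. \<Sum>j<r. c i * conjugate (c j) * (\<Sum>p<n. u i p * conjugate (u j p)))"
    by (subst sum.swap, rule sum.cong[OF refl], subst sum.swap) (simp add: sum_distrib_left)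
  also have "\<dots> = (\<Sum>i<r. c i * conjugate (c i) * (\<Sum>p<n. u i p * conjugate (u i p)))"
  proof (rule sum.cong[OF refl])
    fix i
    assume i: "i \<in> {..<r}"
    have "(\<Sum>j<r. c i * conjugate (c j) * (\<Sum>p<n. u i p * conjugate (u j p)))
        = (\<Sum>j<r. if j = i then c i * conjugate (c i) * (\<Sum>p<n. u i p * conjugate (u i p)) else 0)"
      using i orth by (intro sum.cong) auto
    then show "(\<Sum>j<r. c i * conjugate (c j) * (\<Sum>p<n. u i p * conjugate (u j p)))
        = c i * conjugate (c i) * (\<Sum>p<n. u i p * conjugate (u i p))"
      using i by simp
  qed
  also have "\<dots> = of_real (\<Sum>i<r. (norm (c i))\<^sup>2 * (\<Sum>p<n. (norm (u i p))\<^sup>2))"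
    by (simp only: of_real_sum of_real_mult of_real_norm_square)
  finally show ?thesis
    by (simp only: of_real_eq_iff)
qed

lemma sum_lessThan_double:
  "(\<Sum>i<2 * r. f i) = (\<Sum>i<r. f i + f (r + i))" for f :: "nat \<Rightarrow> 'b :: comm_monoid_add"
proof -
  have "(\<Sum>i<r + k. f i) = (\<Sum>i<r. f i) + (\<Sum>i<k. f (r + i))" for k
    by (induction k) (auto simp: add.assoc)
  from this[of r] show ?thesis
    by (simp add: mult_2 sum.distrib)
qed

text \<open>A real parametrization of an \<open>r\<close>-dimensional subspace: \<open>2 * r\<close> real coordinates stand for
  the real and imaginary parts of the coordinates in an orthonormal basis.\<close>

lemma subspace_of_dim_real_frame:
  fixes V :: "'a :: real_or_complex vec set"
  assumes V: "subspace_of_dim n r V"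
  obtains u :: "nat \<Rightarrow> nat \<Rightarrow> 'a" where
    "\<forall>i<2 * r. (\<Sum>p<n. (norm (u i p))\<^sup>2) \<le> 1"
    "\<forall>\<theta> :: nat \<Rightarrow> real. vec n (\<lambda>p. \<Sum>i<2 * r. of_real (\<theta> i) * u i p) \<in> V"
    "\<forall>x\<in>V. x \<in> carrier_vec n \<and> (\<exists>\<theta> :: nat \<Rightarrow> real.
       (\<forall>p<n. x $ p = (\<Sum>i<2 * r. of_real (\<theta> i) * u i p)) \<and>
       (\<Sum>i<2 * r. (\<theta> i)\<^sup>2) \<le> (l2_norm x)\<^sup>2)"
proof -
  obtain us where us: "set us \<subseteq> carrier_vec n" "length us = r" "corthogonal us"
    "V = LinearCombinations.module.span class_ring (module_vec TYPE('a) n) (set us)"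
    using subspace_of_dim_orthogonal_basis[OF V] .
  have V_iff: "x \<in> V \<longleftrightarrow> x \<in> carrier_vec n \<and> (\<exists>c. \<forall>p<n. x $ p = (\<Sum>i<r. c i * us ! i $ p))" for x
    using span_set_list_iff[OF us(1) corthogonal_distinct[OF us(3)]] us by simp
  have orth: "(\<Sum>p<n. us ! i $ p * conjugate (us ! j $ p)) = 0 \<longleftrightarrow> i \<noteq> j"
    if "i < r" "j < r" for i j
  proof -
    have "us ! i \<in> carrier_vec n" "us ! j \<in> carrier_vec n"
      using that us nth_mem by auto
    then show ?thesis
      using corthogonalD[OF us(3), of i j] that us by (simp add: scalar_prod_def atLeast0LessThan)
  qed
  define L where "L i = sqrt (\<Sum>p<n. (norm (us ! i $ p))\<^sup>2)" for i
  have L2: "(L i)\<^sup>2 = (\<Sum>p<n. (norm (us ! i $ p))\<^sup>2)" for i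
    by (simp add: L_def sum_nonneg)
  have L: "0 < L i" if "i < r" for i
  proof -
    have "(of_real ((L i)\<^sup>2) :: 'a) = (\<Sum>p<n. us ! i $ p * conjugate (us ! i $ p))"
      by (simp only: L2 of_real_sum of_real_norm_square)
    then have "L i \<noteq> 0"
      using orth[OF that that] by auto
    moreover have "0 \<le> L i"
      by (simp add: L_def sum_nonneg)
    ultimately show ?thesis
      by simp
  qed
  define b where "b i p = us ! i $ p / of_real (L i)" for i p
  have b_norm: "(\<Sum>p<n. (norm (b i p))\<^sup>2) = 1" if "i < r" for i
    using L[OF that]
    by (simp add: b_def norm_divide power_divide sum_divide_distrib[symmetric] L2[symmetric])
  have b_orth: "(\<Sum>p<n. b i p * conjugate (b j p)) = 0" if "i < r" "j < r" "i \<noteq> j" for i j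
  proof -
    have "b i p * conjugate (b j p)
        = us ! i $ p * conjugate (us ! j $ p) * (inverse (of_real (L i)) * inverse (of_real (L j)))"
      for p
      unfolding b_def divide_inverse of_real_inverse[symmetric] conjugate_dist_mul conjugate_of_real
      by (simp add: algebra_simps)
    then show ?thesis
      using orth[of i j] that by (simp add: sum_distrib_right[symmetric])
  qed
  obtain j :: 'a where j: "norm j \<le> 1"
    "\<And>z. \<exists>a b. z = of_real a + of_real b * j \<and> a\<^sup>2 + b\<^sup>2 \<le> (norm z)\<^sup>2"
    using ex_imaginary_unit by blast
  \<comment> \<open>The first \<open>r\<close> frame vectors carry the real parts of the
    coordinates, the last \<open>r\<close> the imaginary parts. Over the reals \<open>j\<close> may
    be 0, in which case the second half vanishes; hence norms at most 1 instead of equal to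
    1.\<close>
  define u where "u i p = (if i < r then b i p else j * b (i - r) p)" for i p
  have comb: "(\<Sum>i<2 * r. of_real (\<theta> i) * u i p)
      = (\<Sum>i<r. (of_real (\<theta> i) + of_real (\<theta> (r + i)) * j) * b i p)" for \<theta> :: "nat \<Rightarrow> real" and p
    unfolding sum_lessThan_double by (intro sum.cong) (auto simp: u_def algebra_simps)
  show ?thesis
  proof (rule that[of u]; intro allI ballI impI)
    fix i
    assume i: "i < 2 * r"
    show "(\<Sum>p<n. (norm (u i p))\<^sup>2) \<le> 1"
    proof (cases "i < r")
      case True
      then show ?thesis
        by (simp add: u_def b_norm)
    next
      case False
      then have "(\<Sum>p<n. (norm (u i p))\<^sup>2) = (norm j)\<^sup>2 * (\<Sum>p<n. (norm (b (i - r) p))\<^sup>2)"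
        by (simp add: u_def norm_mult power_mult_distrib sum_distrib_left)
      also have "\<dots> \<le> 1"
        using i False j(1) b_norm[of "i - r"] by (simp add: power_le_one)
      finally show ?thesis .
    qed
  next
    fix \<theta> :: "nat \<Rightarrow> real"
    show "vec n (\<lambda>p. \<Sum>i<2 * r. of_real (\<theta> i) * u i p) \<in> V"
      unfolding V_iff comb
      \<comment> \<open>Dividing by \<open>L i\<close> converts coefficients of the normalized
        vectors \<open>b i\<close> into coefficients of \<open>us ! i\<close>.\<close>
      by (intro conjI exI[of _ "\<lambda>i. (of_real (\<theta> i) + of_real (\<theta> (r + i)) * j) / of_real (L i)"])
        (simp_all add: b_def)
  next
    fix x
    assume "x \<in> V"
    then obtain c where x: "x \<in> carrier_vec n" and c: "\<And>p. p < n \<Longrightarrow> x $ p = (\<Sum>i<r. c i * us ! i $ p)"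
      unfolding V_iff by blast
    have xb: "x $ p = (\<Sum>i<r. (c i * of_real (L i)) * b i p)" if "p < n" for p
      unfolding c[OF that] using L by (intro sum.cong) (auto simp: b_def less_le)
    have "\<forall>i. \<exists>ab. c i * of_real (L i) = of_real (fst ab) + of_real (snd ab) * j \<and>
        (fst ab)\<^sup>2 + (snd ab)\<^sup>2 \<le> (norm (c i * of_real (L i)))\<^sup>2"
      using j(2) by simp
    then obtain \<gamma> where \<gamma>: "\<forall>i. c i * of_real (L i) = of_real (fst (\<gamma> i)) + of_real (snd (\<gamma> i)) * j \<and>
        (fst (\<gamma> i))\<^sup>2 + (snd (\<gamma> i))\<^sup>2 \<le> (norm (c i * of_real (L i)))\<^sup>2"
      using choice[of "\<lambda>i ab. c i * of_real (L i) = of_real (fst ab) + of_real (snd ab) * j \<and>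
        (fst ab)\<^sup>2 + (snd ab)\<^sup>2 \<le> (norm (c i * of_real (L i)))\<^sup>2"] by blast
    define \<alpha> \<beta> where "\<alpha> i = fst (\<gamma> i)" and "\<beta> i = snd (\<gamma> i)" for i
    have ab: "c i * of_real (L i) = of_real (\<alpha> i) + of_real (\<beta> i) * j"
      "(\<alpha> i)\<^sup>2 + (\<beta> i)\<^sup>2 \<le> (norm (c i * of_real (L i)))\<^sup>2" for i
      using \<gamma> unfolding \<alpha>_def \<beta>_def by blast+
    define \<theta> where "\<theta> i = (if i < r then \<alpha> i else \<beta> (i - r))" for i
    have "x $ p = (\<Sum>i<2 * r. of_real (\<theta> i) * u i p)" if "p < n" for p
      unfolding comb xb[OF that] ab(1) by (intro sum.cong) (auto simp: \<theta>_def)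
    moreover have "(\<Sum>i<2 * r. (\<theta> i)\<^sup>2) \<le> (l2_norm x)\<^sup>2"
    proof -
      have "(\<Sum>i<2 * r. (\<theta> i)\<^sup>2) = (\<Sum>i<r. (\<alpha> i)\<^sup>2 + (\<beta> i)\<^sup>2)"
        unfolding sum_lessThan_double by (intro sum.cong) (auto simp: \<theta>_def)
      also have "\<dots> \<le> (\<Sum>i<r. (norm (c i * of_real (L i)))\<^sup>2 * (\<Sum>p<n. (norm (b i p))\<^sup>2))"
        using ab(2) b_norm by (intro sum_mono) auto
      also have "\<dots> = (\<Sum>p<n. (norm (\<Sum>i<r. (c i * of_real (L i)) * b i p))\<^sup>2)"
        by (rule norm_square_orthogonal_sum[symmetric, OF b_orth])
      also have "\<dots> = (l2_norm x)\<^sup>2"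
        using x xb by (simp add: l2_norm_square)
      finally show ?thesis .
    qed
    ultimately show "x \<in> carrier_vec n \<and> (\<exists>\<theta> :: nat \<Rightarrow> real.
       (\<forall>p<n. x $ p = (\<Sum>i<2 * r. of_real (\<theta> i) * u i p)) \<and>
       (\<Sum>i<2 * r. (\<theta> i)\<^sup>2) \<le> (l2_norm x)\<^sup>2)"
      using x by blast
  qed
qed

section \<open>The lower tail of the sketch\<close>

text \<open>As a function of its \<open>i\<close>-th coordinate, \<open>f\<close> is affine with
  slope \<open>g i\<close>, so this is the two-point variance identity with
  \<open>norm (a - b)\<close> scaled by \<open>norm (g i)\<close>.\<close>

lemma norm_real_combination_convex:
  fixes g :: "nat \<Rightarrow> 'a :: real_or_complex"
  assumes "i < m"
  defines "f \<equiv> \<lambda>\<theta> :: nat \<Rightarrow> real. \<Sum>i<m. of_real (\<theta> i) * g i"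
  shows "t * (norm (f (\<theta>(i := a))))\<^sup>2 + (1 - t) * (norm (f (\<theta>(i := b))))\<^sup>2
    = (norm (f (\<theta>(i := t * a + (1 - t) * b))))\<^sup>2 + t * (1 - t) * (a - b)\<^sup>2 * (norm (g i))\<^sup>2"
proof -
  have f: "f (\<theta>(i := y)) = of_real y * g i + (\<Sum>j\<in>{..<m} - {i}. of_real (\<theta> j) * g j)" for y
  proof -
    have "f (\<theta>(i := y)) = of_real ((\<theta>(i := y)) i) * g i
        + (\<Sum>j\<in>{..<m} - {i}. of_real ((\<theta>(i := y)) j) * g j)"
      unfolding f_def using assms(1) by (intro sum.remove) auto
    also have "(\<Sum>j\<in>{..<m} - {i}. of_real ((\<theta>(i := y)) j) * g j)
        = (\<Sum>j\<in>{..<m} - {i}. of_real (\<theta> j) * g j)"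
      by (rule sum.cong) auto
    finally show ?thesis
      by (simp only: fun_upd_same)
  qed
  have "of_real t * f (\<theta>(i := a)) + of_real (1 - t) * f (\<theta>(i := b))
      = f (\<theta>(i := t * a + (1 - t) * b))"
    by (simp add: f algebra_simps)
  moreover have "f (\<theta>(i := a)) - f (\<theta>(i := b)) = of_real (a - b) * g i"
    by (simp add: f algebra_simps)
  ultimately show ?thesis
    using norm_convex_combination_square[of t "f (\<theta>(i := a))" "f (\<theta>(i := b))"]
    by (simp add: norm_mult power_mult_distrib del: of_real_diff)
qed

text \<open>Both forms satisfy the variance identity exactly. Since \<open>c \<ge> 0\<close>, the
  diagonal of the subtracted form only helps and is dropped, leaving the diagonal of the
  first.\<close>

lemma diag_bounded_quadratic_diff:
  fixes g h :: "nat \<Rightarrow> nat \<Rightarrow> 'a :: real_or_complex"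
  assumes "0 \<le> c"
  shows "diag_bounded_quadratic m (\<lambda>i. (\<Sum>j<k. (norm (g i j))\<^sup>2) / \<kappa>)
    (\<lambda>\<theta>. (\<Sum>j<k. (norm (\<Sum>i<m. of_real (\<theta> i) * g i j))\<^sup>2) / \<kappa>
      - c * (\<Sum>p<n. (norm (\<Sum>i<m. of_real (\<theta> i) * h i p))\<^sup>2))"
  unfolding diag_bounded_quadratic_def
proof (intro conjI allI impI)
  fix v v' :: "nat \<Rightarrow> real"
  assume "\<forall>i<m. v i = v' i"
  then have "(\<Sum>i<m. of_real (v i) * f i) = (\<Sum>i<m. of_real (v' i) * f i)" for f :: "nat \<Rightarrow> 'a"
    by (intro sum.cong) auto
  then show "(\<Sum>j<k. (norm (\<Sum>i<m. of_real (v i) * g i j))\<^sup>2) / \<kappa>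
      - c * (\<Sum>p<n. (norm (\<Sum>i<m. of_real (v i) * h i p))\<^sup>2)
    = (\<Sum>j<k. (norm (\<Sum>i<m. of_real (v' i) * g i j))\<^sup>2) / \<kappa>
      - c * (\<Sum>p<n. (norm (\<Sum>i<m. of_real (v' i) * h i p))\<^sup>2)"
    by simp
next
  fix \<theta> :: "nat \<Rightarrow> real" and i and a b t :: real
  assume i: "i < m" and t: "0 \<le> t" "t \<le> 1"
  let ?S = "\<lambda>n (f :: nat \<Rightarrow> nat \<Rightarrow> 'a) \<theta>. \<Sum>p<n. (norm (\<Sum>i<m. of_real (\<theta> i) * f i p))\<^sup>2"
  have S: "t * ?S n f (\<theta>(i := a)) + (1 - t) * ?S n f (\<theta>(i := b))
      = ?S n f (\<theta>(i := t * a + (1 - t) * b)) + t * (1 - t) * (a - b)\<^sup>2 * (\<Sum>p<n. (norm (f i p))\<^sup>2)"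
    for n f
    unfolding sum_distrib_left sum.distrib[symmetric]
    by (intro sum.cong refl norm_real_combination_convex i)
  have split: "t * (A / \<kappa> - c * B) + (1 - t) * (A' / \<kappa> - c * B')
      = (t * A + (1 - t) * A') / \<kappa> - c * (t * B + (1 - t) * B')" for A A' B B'
    by (simp add: algebra_simps add_divide_distrib diff_divide_distrib)
  have "t * (?S k g (\<theta>(i := a)) / \<kappa> - c * ?S n h (\<theta>(i := a)))
        + (1 - t) * (?S k g (\<theta>(i := b)) / \<kappa> - c * ?S n h (\<theta>(i := b)))
      = (t * ?S k g (\<theta>(i := a)) + (1 - t) * ?S k g (\<theta>(i := b))) / \<kappa>
        - c * (t * ?S n h (\<theta>(i := a)) + (1 - t) * ?S n h (\<theta>(i := b)))"
    by (rule split)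
  also have "\<dots> = ?S k g (\<theta>(i := t * a + (1 - t) * b)) / \<kappa> - c * ?S n h (\<theta>(i := t * a + (1 - t) * b))
      + t * (1 - t) * (a - b)\<^sup>2 * ((\<Sum>j<k. (norm (g i j))\<^sup>2) / \<kappa>)
      - c * (t * (1 - t) * (a - b)\<^sup>2 * (\<Sum>p<n. (norm (h i p))\<^sup>2))"
    unfolding S by (simp only: add_divide_distrib distrib_left times_divide_eq_right)
  also have "\<dots> \<le> ?S k g (\<theta>(i := t * a + (1 - t) * b)) / \<kappa> - c * ?S n h (\<theta>(i := t * a + (1 - t) * b))
      + t * (1 - t) * (a - b)\<^sup>2 * ((\<Sum>j<k. (norm (g i j))\<^sup>2) / \<kappa>)"
    using assms t by (simp add: sum_nonneg)
  finally show "t * (?S k g (\<theta>(i := a)) / \<kappa> - c * ?S n h (\<theta>(i := a)))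
        + (1 - t) * (?S k g (\<theta>(i := b)) / \<kappa> - c * ?S n h (\<theta>(i := b)))
      \<le> ?S k g (\<theta>(i := t * a + (1 - t) * b)) / \<kappa> - c * ?S n h (\<theta>(i := t * a + (1 - t) * b))
      + t * (1 - t) * (a - b)\<^sup>2 * ((\<Sum>j<k. (norm (g i j))\<^sup>2) / \<kappa>)" .
qed

section \<open>The columns of the Khatri-Rao matrix and the energy of the sketch\<close>

definition col_indices :: "nat \<Rightarrow> nat \<Rightarrow> (nat \<times> nat) list" where
  "col_indices l j = map (\<lambda>i. (j, i)) [0..<l]"

lemma length_col_indices [simp]: "length (col_indices l j) = l"
  by (simp add: col_indices_def)

lemma set_col_indices: "set (col_indices l j) = {j} \<times> {..<l}"
  by (auto simp: col_indices_def)

lemma distinct_col_indices [simp]: "distinct (col_indices l j)"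
  by (simp add: col_indices_def distinct_map inj_on_def)

text \<open>The squared norm of the sketched vector, written without matrices so that measurability
  and moments come directly from \<open>kron_inner\<close>. The division by \<open>k\<close> is the
  square of the normalization of the matrix.\<close>

definition sketch_energy ::
  "nat \<Rightarrow> nat \<Rightarrow> nat \<Rightarrow> (nat \<Rightarrow> 'a) \<Rightarrow> (nat \<times> nat \<Rightarrow> 'a :: {conjugatable_field, real_normed_field} vec)
    \<Rightarrow> real" where
  "sketch_energy d l k x w = (\<Sum>j<k. (norm (kron_inner d (col_indices l j) x w))\<^sup>2) / real k"

lemma kron_inner_sum:
  "kron_inner d js (\<lambda>p. \<Sum>i<m. c i * u i p) w = (\<Sum>i<m. c i * kron_inner d js (u i) w)"
  unfolding kron_inner_def sum_distrib_right sum_distrib_left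
  by (subst sum.swap) (simp add: mult.assoc)

lemma khatri_rao_mat_carrier: "khatri_rao_mat d l k w \<in> carrier_mat (d ^ l) k"
proof -
  have "mat_of_cols (d ^ l) (map (\<lambda>j. kron_list (map (\<lambda>i. w (j, i)) [0..<l])) [0..<k])
      \<in> carrier_mat (d ^ l) k"
    by (rule carrier_matI) (simp_all only: mat_of_cols_carrier length_map length_upt diff_zero)
  then show ?thesis
    unfolding khatri_rao_mat_def by (rule smult_carrier_mat)
qed

lemma khatri_rao_mat_index:
  assumes "\<And>j i. j < k \<Longrightarrow> i < l \<Longrightarrow> dim_vec (w (j, i)) = d" "0 < d" "p < d ^ l" "j < k"
  shows "khatri_rao_mat d l k w $$ (p, j)
    = of_real (1 / sqrt (real k)) * kron_coeff d (col_indices l j) w p"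
proof -
  have "kron_list (map (\<lambda>i. w (j, i)) [0..<l]) = kron_list (map w (col_indices l j))"
    by (simp add: col_indices_def comp_def)
  also have "\<dots> = vec (d ^ l) (kron_coeff d (col_indices l j) w)"
    using assms by (subst kron_list_map) (auto simp: set_col_indices)
  finally show ?thesis
    using assms by (simp add: khatri_rao_mat_def mat_of_cols_index)
qed

lemma l2_norm_adjoint_khatri_rao:
  fixes w :: "nat \<times> nat \<Rightarrow> 'a :: real_or_complex vec"
  assumes w: "\<And>j i. j < k \<Longrightarrow> i < l \<Longrightarrow> dim_vec (w (j, i)) = d" and d: "0 < d"
    and x: "x \<in> carrier_vec (d ^ l)"
  shows "(l2_norm (mat_adjoint (khatri_rao_mat d l k w) *\<^sub>v x))\<^sup>2 = sketch_energy d l k (($) x) w"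
proof -
  let ?A = "khatri_rao_mat d l k w"
  have A: "dim_row ?A = d ^ l" "dim_col ?A = k"
    using khatri_rao_mat_carrier[of d l k w] by auto
  have entry: "(mat_adjoint ?A *\<^sub>v x) $ j
      = of_real (1 / sqrt (real k)) * kron_inner d (col_indices l j) (($) x) w" if j: "j < k" for j
  proof -
    have "(mat_adjoint ?A *\<^sub>v x) $ j = (\<Sum>p<d ^ l. conjugate (?A $$ (p, j)) * x $ p)"
    proof -
      have "col ?A j \<in> carrier_vec (d ^ l)"
        by (rule col_carrier_vec) (use j A khatri_rao_mat_carrier in auto)
      then have "row (mat_adjoint ?A) j = conjugate (col ?A j)"
        using j A by (simp add: mat_adjoint_def)
      moreover have "j < dim_row (mat_adjoint ?A)"
        using j A by (simp add: mat_adjoint_def)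
      ultimately show ?thesis
        using x j A by (simp add: scalar_prod_def atLeast0LessThan)
    qed
    also have "\<dots> = (\<Sum>p<d ^ l. of_real (1 / sqrt (real k))
        * (x $ p * conjugate (kron_coeff d (col_indices l j) w p)))"
    proof (rule sum.cong[OF refl])
      fix p
      assume "p \<in> {..<d ^ l}"
      then have "?A $$ (p, j) = of_real (1 / sqrt (real k)) * kron_coeff d (col_indices l j) w p"
        by (intro khatri_rao_mat_index w d j) auto
      then show "conjugate (?A $$ (p, j)) * x $ p = of_real (1 / sqrt (real k))
          * (x $ p * conjugate (kron_coeff d (col_indices l j) w p))"
        by (simp only: conjugate_dist_mul conjugate_of_real mult.assoc mult.commute mult.left_commute)
    qed
    finally show ?thesis
      by (simp only: kron_inner_def sum_distrib_left length_col_indices)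
  qed
  have "dim_vec (mat_adjoint ?A *\<^sub>v x) = k"
    by (simp add: mat_adjoint_def A)
  then have "(l2_norm (mat_adjoint ?A *\<^sub>v x))\<^sup>2
      = (\<Sum>j<k. (norm (of_real (1 / sqrt (real k)) * kron_inner d (col_indices l j) (($) x) w))\<^sup>2)"
    by (simp add: l2_norm_square entry del: index_mult_mat_vec)
  also have "\<dots> = sketch_energy d l k (($) x) w"
    by (simp add: sketch_energy_def norm_mult norm_divide power_mult_distrib power_divide
        sum_divide_distrib)
  finally show ?thesis .
qed

section \<open>Moments, independence and lower tail of the sketch energy\<close>

context base_distribution
begin

context
  fixes l k :: nat
begin

abbreviation "M \<equiv> factor_space l k N"
abbreviation "Y \<equiv> \<lambda>j. kron_inner d (col_indices l j)"

lemma prob_space_factor_space: "prob_space M"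
  unfolding factor_space_def by (rule prob_space_PiM) unfold_locales

lemma dim_vec_factor:
  assumes "w \<in> space M" "j < k" "i < l"
  shows "dim_vec (w (j, i)) = d"
proof -
  have "w (j, i) \<in> space N"
    using assms by (auto simp: factor_space_def space_PiM PiE_iff)
  then show ?thesis
    by (simp add: space_N)
qed

lemma l2_norm_sketch:
  assumes "w \<in> space M" "x \<in> carrier_vec (d ^ l)"
  shows "(l2_norm (mat_adjoint (khatri_rao_mat d l k w) *\<^sub>v x))\<^sup>2 = sketch_energy d l k (($) x) w"
  using assms d_pos by (intro l2_norm_adjoint_khatri_rao dim_vec_factor) auto

lemma col_measurable [measurable]:
  assumes "j < k"
  shows "Y j x \<in> borel_measurable M"
  unfolding factor_space_def
  using assms by (intro kron_inner_measurable) (auto simp: set_col_indices)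

lemma sketch_energy_measurable [measurable]: "sketch_energy d l k x \<in> borel_measurable M"
  unfolding sketch_energy_def[abs_def] by (intro borel_measurable_divide borel_measurable_sum
      borel_measurable_power borel_measurable_norm borel_measurable_const) simp

lemma random_mat_khatri_rao: "random_mat M (d ^ l) k (khatri_rao_mat d l k)"
  unfolding random_mat_def
proof (intro conjI ballI allI impI)
  show "prob_space M"
    by (rule prob_space_factor_space)
  show "khatri_rao_mat d l k w \<in> carrier_mat (d ^ l) k" for w :: "nat \<times> nat \<Rightarrow> 'a vec"
    by (rule khatri_rao_mat_carrier)
  fix p j
  assume p: "p < d ^ l" and j: "j < k"
  have "(\<lambda>w. kron_coeff d (col_indices l j) w p) \<in> borel_measurable M"
    unfolding factor_space_def using p j by (intro kron_coeff_measurable) (auto simp: set_col_indices)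
  then have "(\<lambda>w. of_real (1 / sqrt (real k)) * kron_coeff d (col_indices l j) w p)
      \<in> borel_measurable M"
    by (intro borel_measurable_times borel_measurable_const)
  moreover have "khatri_rao_mat d l k w $$ (p, j)
      = of_real (1 / sqrt (real k)) * kron_coeff d (col_indices l j) w p" if "w \<in> space M" for w
    using that p j d_pos by (intro khatri_rao_mat_index dim_vec_factor) auto
  ultimately show "(\<lambda>w. khatri_rao_mat d l k w $$ (p, j)) \<in> borel_measurable M"
    by (simp cong: measurable_cong)
qed

lemma col_second_moment:
  assumes "j < k"
  shows "has_bochner_integral M (\<lambda>w. (norm (Y j x w))\<^sup>2) (\<Sum>p<d ^ l. (norm (x p))\<^sup>2)"
proof (rule has_bochner_integral_nn_integral)
  show "(\<integral>\<^sup>+w. ennreal ((norm (Y j x w))\<^sup>2) \<partial>M) = ennreal (\<Sum>p<d ^ l. (norm (x p))\<^sup>2)"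
    unfolding factor_space_def using assms
    by (subst kron_inner_second_moment) (auto simp: set_col_indices)
qed (use assms in \<open>auto intro: sum_nonneg\<close>)

lemma col_fourth_moment:
  assumes "j < k"
  shows "integrable M (\<lambda>w. norm (Y j x w) ^ 4)"
    and "(\<integral>w. norm (Y j x w) ^ 4 \<partial>M) \<le> C ^ l * (\<Sum>p<d ^ l. (norm (x p))\<^sup>2)\<^sup>2"
proof -
  have le: "(\<integral>\<^sup>+w. ennreal (norm (Y j x w) ^ 4) \<partial>M) \<le> ennreal (C ^ l * (\<Sum>p<d ^ l. (norm (x p))\<^sup>2)\<^sup>2)"
    unfolding factor_space_def using assms kron_inner_fourth_moment[of "{..<k} \<times> {..<l}" "col_indices l j" x]
    by (auto simp: set_col_indices)
  show int: "integrable M (\<lambda>w. norm (Y j x w) ^ 4)"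
    using assms le by (intro integrableI_bounded) (auto simp: top_unique less_top intro: le_less_trans)
  show "(\<integral>w. norm (Y j x w) ^ 4 \<partial>M) \<le> C ^ l * (\<Sum>p<d ^ l. (norm (x p))\<^sup>2)\<^sup>2"
    using le C_ge_1 by (subst (asm) nn_integral_eq_integral[OF int]) (auto simp: ennreal_le_iff)
qed

lemma sketch_energy_expectation:
  assumes "0 < k"
  shows "has_bochner_integral M (sketch_energy d l k x) (\<Sum>p<d ^ l. (norm (x p))\<^sup>2)"
proof -
  have "has_bochner_integral M (\<lambda>w. (\<Sum>j<k. (norm (Y j x w))\<^sup>2) / real k)
      ((\<Sum>j<k. \<Sum>p<d ^ l. (norm (x p))\<^sup>2) / real k)"
    by (intro has_bochner_integral_divide_zero has_bochner_integral_sum col_second_moment) simp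
  then show ?thesis
    using assms by (simp add: sketch_energy_def[abs_def])
qed

text \<open>Different columns are functions of disjoint blocks of the independent
  coordinates.\<close>

lemma indep_cols:
  "prob_space.indep_vars M (\<lambda>_. borel) (\<lambda>j. Y j x) {..<k}"
proof -
  interpret M: prob_space M
    by (rule prob_space_factor_space)
  let ?I = "{..<k} \<times> {..<l}"
  let ?K = "\<lambda>j. set (col_indices l j)"
  have coord: "M.indep_vars (\<lambda>_. N) (\<lambda>i w. w i) ?I"
  \<comment> \<open>Independence is tested by comparing the joint law with the product of the
    marginals; that criterion is for nonempty families.\<close>
  proof (cases "?I = {}")
    case True
    have "M.indep_vars (\<lambda>_. N) (\<lambda>i w. w i) {}"
      by (auto simp: M.indep_vars_def M.indep_sets_def)
    then show ?thesis
      by (simp only: True)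
  next
    case False
    have "distr M (\<Pi>\<^sub>M i\<in>?I. N) (\<lambda>w. \<lambda>i\<in>?I. w i) = M"
      unfolding factor_space_def
      using distr_PiM_reindex[of ?I "\<lambda>_. N" "\<lambda>i. i" ?I] by (simp add: prob_space_axioms)
    moreover have "(\<Pi>\<^sub>M i\<in>?I. distr M N (\<lambda>w. w i)) = M"
      unfolding factor_space_def
      by (intro PiM_cong refl distr_PiM_component) (auto intro: prob_space_axioms)
    ultimately show ?thesis
      using False by (subst M.indep_vars_iff_distr_eq_PiM') (auto simp: factor_space_def)
  qed
  have "M.indep_vars (\<lambda>j. \<Pi>\<^sub>M i\<in>?K j. N) (\<lambda>j w. restrict w (?K j)) {..<k}"
    by (rule M.indep_vars_restrict[OF coord]) (auto simp: set_col_indices disjoint_family_on_def)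
  then have "M.indep_vars (\<lambda>_. borel) (\<lambda>j w. Y j x (restrict w (?K j))) {..<k}"
    by (rule M.indep_vars_compose2) (rule kron_inner_measurable[OF order_refl])
  moreover have "Y j x (restrict w (?K j)) = Y j x w" for j w
    by (rule kron_inner_cong) simp
  ultimately show ?thesis
    by simp
qed

text \<open>Integrating \<open>exp (- y) \<le> 1 - y + y\<^sup>2 / 2\<close> at
  \<open>y = t * (norm (Y j x w))\<^sup>2\<close> brings in just the second and fourth moments;
  \<open>1 + z \<le> exp z\<close> then gives a form that multiplies well over the columns.\<close>

lemma col_laplace:
  fixes x :: "nat \<Rightarrow> 'a"
  assumes j: "j < k" and t: "0 \<le> t"
  defines "S \<equiv> \<Sum>p<d ^ l. (norm (x p))\<^sup>2"
  shows "(\<integral>w. exp (- (t * (norm (Y j x w))\<^sup>2)) \<partial>M) \<le> exp (- t * S + t\<^sup>2 * C ^ l * S\<^sup>2 / 2)"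
proof -
  interpret M: prob_space M
    by (rule prob_space_factor_space)
  have second: "integrable M (\<lambda>w. (norm (Y j x w))\<^sup>2)" "(\<integral>w. (norm (Y j x w))\<^sup>2 \<partial>M) = S"
    using col_second_moment[OF j, of x] by (auto simp: has_bochner_integral_iff S_def)
  have [simp]: "((norm z)\<^sup>2)\<^sup>2 = norm z ^ 4" for z :: 'a
    by simp
  have "(\<integral>w. exp (- (t * (norm (Y j x w))\<^sup>2)) \<partial>M)
      \<le> (\<integral>w. 1 - t * (norm (Y j x w))\<^sup>2 + t\<^sup>2 / 2 * norm (Y j x w) ^ 4 \<partial>M)"
  proof (rule integral_mono)
    show "integrable M (\<lambda>w. exp (- (t * (norm (Y j x w))\<^sup>2)))"
      using j t by (intro M.integrable_const_bound[where B = 1]) auto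
    show "integrable M (\<lambda>w. 1 - t * (norm (Y j x w))\<^sup>2 + t\<^sup>2 / 2 * norm (Y j x w) ^ 4)"
      using second col_fourth_moment[OF j] by auto
    show "exp (- (t * (norm (Y j x w))\<^sup>2)) \<le> 1 - t * (norm (Y j x w))\<^sup>2 + t\<^sup>2 / 2 * norm (Y j x w) ^ 4" for w
      using exp_minus_le_quadratic[of "t * (norm (Y j x w))\<^sup>2"] t by (simp add: power_mult_distrib)
  qed
  also have "\<dots> = 1 - t * S + t\<^sup>2 / 2 * (\<integral>w. norm (Y j x w) ^ 4 \<partial>M)"
    using second col_fourth_moment(1)[OF j] by (simp add: M.prob_space)
  also have "\<dots> \<le> 1 - t * S + t\<^sup>2 / 2 * (C ^ l * S\<^sup>2)"
    using col_fourth_moment(2)[OF j, of x] unfolding S_def by (intro add_left_mono mult_left_mono) auto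
  also have "\<dots> = 1 + (- t * S + t\<^sup>2 * C ^ l * S\<^sup>2 / 2)"
    by (simp add: mult.assoc)
  also have "\<dots> \<le> exp (- t * S + t\<^sup>2 * C ^ l * S\<^sup>2 / 2)"
    by (rule exp_ge_add_one_self)
  finally show ?thesis .
qed

lemma sketch_energy_lower_tail:
  fixes x :: "nat \<Rightarrow> 'a"
  assumes k: "0 < k"
  defines "S \<equiv> \<Sum>p<d ^ l. (norm (x p))\<^sup>2"
  shows "measure M {w \<in> space M. sketch_energy d l k x w < 3 / 4 * S} \<le> exp (- real k / (32 * C ^ l))"
proof (cases "S = 0")
  case True
  have "\<not> sketch_energy d l k x w < 0" for w
    by (simp add: sketch_energy_def sum_nonneg not_less)
  then have "{w \<in> space M. sketch_energy d l k x w < 3 / 4 * S} = {}"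
    using True by auto
  then show ?thesis
    by (simp only: measure_empty exp_ge_zero)
next
  case False
  interpret M: prob_space M
    by (rule prob_space_factor_space)
  have S: "0 < S"
    using False by (simp add: S_def sum_nonneg order.not_eq_order_implies_strict)
  have h: "0 < C ^ l"
    using C_ge_1 by simp
  \<comment> \<open>This \<open>t\<close> minimizes the exponent
    \<open>- t * S / 4 + t\<^sup>2 * C ^ l * S\<^sup>2 / 2\<close> per column; the minimum is
    \<open>- 1 / (32 * C ^ l)\<close>.\<close>
  define t where "t = 1 / (4 * C ^ l * S)"
  have t: "0 < t"
    using S h by (simp add: t_def)
  let ?Z = "\<lambda>w. \<Sum>j<k. (norm (Y j x w))\<^sup>2"
  let ?X = "\<lambda>j w. exp (- (t * (norm (Y j x w))\<^sup>2))"
  have X_int: "integrable M (?X j)" if "j \<in> {..<k}" for j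
    using that t by (intro M.integrable_const_bound[where B = 1]) auto
  have X_indep: "M.indep_vars (\<lambda>_. borel) ?X {..<k}"
    by (rule M.indep_vars_compose2[OF indep_cols]) measurable
  have exp_sum: "exp (- t * ?Z w) = (\<Prod>j<k. ?X j w)" for w
    by (simp add: exp_sum[symmetric] sum_distrib_left sum_negf)
  have int: "integrable M (\<lambda>w. exp (- t * ?Z w))"
    unfolding exp_sum using X_indep X_int by (intro M.indep_vars_integrable) auto
  have "(\<integral>w. exp (- t * ?Z w) \<partial>M) = (\<Prod>j<k. \<integral>w. ?X j w \<partial>M)"
    unfolding exp_sum using X_indep X_int by (intro M.indep_vars_lebesgue_integral) auto
  also have "\<dots> \<le> (\<Prod>j<k. exp (- t * S + t\<^sup>2 * C ^ l * S\<^sup>2 / 2))"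
    unfolding S_def using t by (intro prod_mono conjI col_laplace integral_nonneg) simp_all
  also have "\<dots> = exp (real k * (- t * S + t\<^sup>2 * C ^ l * S\<^sup>2 / 2))"
    by (simp add: exp_of_nat_mult)
  finally have laplace: "(\<integral>w. exp (- t * ?Z w) \<partial>M) \<le> exp (real k * (- t * S + t\<^sup>2 * C ^ l * S\<^sup>2 / 2))" .
  have "measure M {w \<in> space M. sketch_energy d l k x w < 3 / 4 * S}
      \<le> measure M {w \<in> space M. ?Z w \<le> 3 / 4 * S * real k}"
    using k by (intro M.finite_measure_mono) (auto simp: sketch_energy_def field_simps)
  also have "\<dots> \<le> exp (t * (3 / 4 * S * real k)) * (\<integral>w\<in>space M. exp (- t * ?Z w) \<partial>M)"
  proof (rule M.Chernoff_ineq_le[OF t])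
    show "set_integrable M (space M) (\<lambda>w. exp (- t * ?Z w))"
      unfolding set_integrable_def by (rule integrable_mult_indicator[OF sets.top int])
  qed simp
  also have "\<dots> \<le> exp (t * (3 / 4 * S * real k)) * exp (real k * (- t * S + t\<^sup>2 * C ^ l * S\<^sup>2 / 2))"
    by (subst set_integral_space[OF int]) (intro mult_left_mono laplace exp_ge_zero)
  also have "\<dots> = exp (- real k / (32 * C ^ l))"
  proof -
    have tS: "t * S = 1 / (4 * C ^ l)"
      using S by (simp add: t_def)
    have "t\<^sup>2 * C ^ l * S\<^sup>2 = (t * S)\<^sup>2 * C ^ l"
      by (simp add: power_mult_distrib)
    also have "\<dots> = 1 / (16 * C ^ l)"
      unfolding tS using h by (simp add: power2_eq_square)
    finally have "t\<^sup>2 * C ^ l * S\<^sup>2 = 1 / (16 * C ^ l)" .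
    then have "t * (3 / 4 * S * real k) + real k * (- t * S + t\<^sup>2 * C ^ l * S\<^sup>2 / 2)
        = 3 / 4 * real k * (t * S) + real k * (- (t * S) + 1 / (16 * C ^ l) / 2)"
      by simp
    also have "\<dots> = - real k / (32 * C ^ l)"
      unfolding tS using h by (simp add: field_simps)
    finally have "t * (3 / 4 * S * real k) + real k * (- t * S + t\<^sup>2 * C ^ l * S\<^sup>2 / 2)
        = - real k / (32 * C ^ l)" .
    then show ?thesis
      by (simp only: exp_add[symmetric])
  qed
  finally show ?thesis .
qed

end

end

section \<open>Embedding of a subspace\<close>

lemma sketch_energy_nonneg: "0 \<le> sketch_energy d l k x w"
  by (simp add: sketch_energy_def sum_nonneg)

lemma sketch_energy_cong:
  "(\<And>p. p < d ^ l \<Longrightarrow> x p = y p) \<Longrightarrow> sketch_energy d l k x w = sketch_energy d l k y w"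
  by (simp add: sketch_energy_def kron_inner_def)

lemma sketch_energy_scale:
  "sketch_energy d l k (\<lambda>p. c * x p) w = (norm c)\<^sup>2 * sketch_energy d l k x w"
proof -
  have "kron_inner d js (\<lambda>p. c * x p) w = c * kron_inner d js x w" for js :: "(nat \<times> nat) list"
    by (simp add: kron_inner_def sum_distrib_left mult.assoc)
  then show ?thesis
    by (simp add: sketch_energy_def norm_mult power_mult_distrib sum_distrib_left)
qed

definition real_comb :: "nat \<Rightarrow> (nat \<Rightarrow> nat \<Rightarrow> 'a :: real_or_complex) \<Rightarrow> (nat \<Rightarrow> real) \<Rightarrow> nat \<Rightarrow> 'a" where
  "real_comb m u \<theta> p = (\<Sum>i<m. of_real (\<theta> i) * u i p)"

lemma real_comb_scale: "real_comb m u (\<lambda>i. c * \<theta> i) p = of_real c * real_comb m u \<theta> p"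
  by (simp add: real_comb_def sum_distrib_left mult.assoc)

lemma diag_bounded_quadratic_sketch:
  assumes "0 \<le> c"
  shows "diag_bounded_quadratic m (\<lambda>i. sketch_energy d l k (u i) w)
    (\<lambda>\<theta>. sketch_energy d l k (real_comb m u \<theta>) w - c * (\<Sum>p<n. (norm (real_comb m u \<theta> p))\<^sup>2))"
  using diag_bounded_quadratic_diff[OF assms, where g = "\<lambda>i j. kron_inner d (col_indices l j) (u i) w"
      and k = k and \<kappa> = "real k" and h = u and n = n and m = m]
  by (simp add: sketch_energy_def real_comb_def[abs_def] kron_inner_sum)

text \<open>Cauchy-Schwarz against the constant vector; it places the Euclidean unit ball inside the
  sum-norm ball covered by the grid.\<close>

lemma sum_abs_le_sqrt:
  fixes v :: "nat \<Rightarrow> real"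
  assumes "(\<Sum>i<m. (v i)\<^sup>2) \<le> 1"
  shows "(\<Sum>i<m. \<bar>v i\<bar>) \<le> sqrt (real m)"
proof (rule real_le_rsqrt)
  have "(\<Sum>i<m. \<bar>v i\<bar>)\<^sup>2 \<le> (\<Sum>i<m. \<bar>v i\<bar>\<^sup>2) * real m"
    using sum_squared_le_sum_of_squares[of "\<lambda>i. \<bar>v i\<bar>" "{..<m}"] by simp
  also have "\<dots> \<le> 1 * real m"
    using assms by (intro mult_right_mono) auto
  finally show "(\<Sum>i<m. \<bar>v i\<bar>)\<^sup>2 \<le> real m"
    by simp
qed

text \<open>With mesh \<open>s = 1 / (7 * sqrt m)\<close> a point of the unit ball is rounded into the grid points of
  \<open>l1_ball m (8 * m)\<close>, and rounding costs at most \<open>s\<^sup>2 / 4 * 40 * m < 1 / 4\<close>.\<close>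

lemma energy_lower_bound_from_grid:
  fixes u :: "nat \<Rightarrow> nat \<Rightarrow> 'a :: real_or_complex"
  assumes m: "1 \<le> m"
    and grid: "\<And>z. z \<in> l1_ball m (8 * m) \<Longrightarrow>
      3 / 4 * (\<Sum>p<n. (norm (real_comb m u (\<lambda>i. 1 / (7 * sqrt m) * of_int (z i)) p))\<^sup>2)
        \<le> sketch_energy d l k (real_comb m u (\<lambda>i. 1 / (7 * sqrt m) * of_int (z i))) w"
    and trace: "(\<Sum>i<m. sketch_energy d l k (u i) w) \<le> 40 * real m"
    and v: "(\<Sum>i<m. (v i)\<^sup>2) \<le> 1"
    and unit: "(\<Sum>p<n. (norm (real_comb m u v p))\<^sup>2) = 1"
  shows "1 / 2 \<le> sketch_energy d l k (real_comb m u v) w"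
proof -
  define s where "s = 1 / (7 * sqrt (real m))"
  have s: "0 < s"
    using m by (simp add: s_def)
  define q where "q \<theta> = sketch_energy d l k (real_comb m u \<theta>) w
    - 3 / 4 * (\<Sum>p<n. (norm (real_comb m u \<theta> p))\<^sup>2)" for \<theta>
  have q: "diag_bounded_quadratic m (\<lambda>i. sketch_energy d l k (u i) w) q"
    unfolding q_def[abs_def] by (rule diag_bounded_quadratic_sketch) simp
  obtain z :: "nat \<Rightarrow> int" where z: "\<And>i. i < m \<Longrightarrow> \<bar>s * of_int (z i) - v i\<bar> \<le> s"
    "q (\<lambda>i. s * of_int (z i)) \<le> q v + s\<^sup>2 / 4 * (\<Sum>i<m. sketch_energy d l k (u i) w)"
    using ex_rounding[OF q sketch_energy_nonneg s, of v] by blast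
  \<comment> \<open>Restriction makes the point extensional, as membership in \<open>l1_ball\<close>
    requires. Rounding gives \<open>\<bar>z i\<bar> \<le> \<bar>v i\<bar> / s + 1\<close>, and the
    sum over \<open>i\<close> is at most \<open>7 * m + m\<close>.\<close>
  define z' where "z' = restrict z {..<m}"
  have "real (\<Sum>i<m. nat \<bar>z' i\<bar>) = (\<Sum>i<m. \<bar>of_int (z i)\<bar>)"
    by (auto simp: z'_def intro!: sum.cong)
  also have "\<dots> \<le> (\<Sum>i<m. \<bar>v i\<bar> / s + 1)"
  proof (rule sum_mono)
    fix i
    assume "i \<in> {..<m}"
    then have "s * \<bar>of_int (z i)\<bar> \<le> \<bar>v i\<bar> + s"
      using z(1)[of i] s abs_mult[of s "of_int (z i)"] by auto
    then show "\<bar>of_int (z i)\<bar> \<le> \<bar>v i\<bar> / s + 1"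
      using s by (simp add: field_simps)
  qed
  also have "\<dots> = (\<Sum>i<m. \<bar>v i\<bar>) * (7 * sqrt (real m)) + real m"
    by (simp add: sum.distrib sum_distrib_right s_def)
  also have "\<dots> \<le> sqrt (real m) * (7 * sqrt (real m)) + real m"
    by (intro add_right_mono mult_right_mono sum_abs_le_sqrt v) auto
  also have "\<dots> = real (8 * m)"
    by simp
  finally have "z' \<in> l1_ball m (8 * m)"
    by (simp add: l1_ball_def z'_def del: of_nat_sum of_nat_mult)
  then have "0 \<le> q (\<lambda>i. s * of_int (z' i))"
    unfolding q_def s_def using grid by simp
  also have "q (\<lambda>i. s * of_int (z' i)) = q (\<lambda>i. s * of_int (z i))"
    using q unfolding diag_bounded_quadratic_def by (simp add: z'_def)
  also have "\<dots> \<le> q v + s\<^sup>2 / 4 * (40 * real m)"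
    using z(2) mult_left_mono[OF trace, of "s\<^sup>2 / 4"] by simp
  also have "s\<^sup>2 / 4 * (40 * real m) = 10 / 49"
    using m by (simp add: s_def power_divide power_mult_distrib)
  finally show ?thesis
    by (simp add: q_def unit)
qed

section \<open>Measurability and probability of the embedding event\<close>

context base_distribution
begin

text \<open>The event is an intersection over all vectors of \<open>V\<close>. It is reduced to
  countably many conditions on grid points, whose rounding error tends to 0 with the mesh.\<close>

lemma embedding_event_measurable:
  assumes V: "subspace_of_dim (d ^ l) r V" and \<alpha>: "0 \<le> \<alpha>"
  shows "{w \<in> space (factor_space l k N). \<forall>x\<in>V. \<alpha> * (l2_norm x)\<^sup>2
      \<le> (l2_norm (mat_adjoint (khatri_rao_mat d l k w) *\<^sub>v x))\<^sup>2} \<in> sets (factor_space l k N)"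
proof -
  let ?M = "factor_space l k N"
  let ?m = "2 * r"
  obtain u :: "nat \<Rightarrow> nat \<Rightarrow> 'a" where
    "\<forall>i<?m. (\<Sum>p<d ^ l. (norm (u i p))\<^sup>2) \<le> 1"
    and u: "\<forall>\<theta> :: nat \<Rightarrow> real. vec (d ^ l) (\<lambda>p. \<Sum>i<?m. of_real (\<theta> i) * u i p) \<in> V"
    "\<forall>x\<in>V. x \<in> carrier_vec (d ^ l) \<and> (\<exists>\<theta> :: nat \<Rightarrow> real.
       (\<forall>p<d ^ l. x $ p = (\<Sum>i<?m. of_real (\<theta> i) * u i p)) \<and>
       (\<Sum>i<?m. (\<theta> i)\<^sup>2) \<le> (l2_norm x)\<^sup>2)"
    using subspace_of_dim_real_frame[OF V] .
  define q where "q w \<theta> = sketch_energy d l k (real_comb ?m u \<theta>) w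
    - \<alpha> * (\<Sum>p<d ^ l. (norm (real_comb ?m u \<theta> p))\<^sup>2)" for w \<theta>
  have q: "diag_bounded_quadratic ?m (\<lambda>i. sketch_energy d l k (u i) w) (q w)" for w
    unfolding q_def[abs_def] by (rule diag_bounded_quadratic_sketch[OF \<alpha>])
  \<comment> \<open>Integer lists form a countable type, unlike functions on the naturals, so this
    is a countable conjunction. A list shorter than \<open>2 * r\<close> still determines some
    parameter vector, where nonnegativity of the form everywhere applies as well.\<close>
  define P where "P w \<longleftrightarrow> (\<forall>n :: nat. \<forall>zs :: int list. 0 \<le> q w (\<lambda>i. 1 / real (Suc n) * of_int (zs ! i)))" for w
  have "(\<forall>x\<in>V. \<alpha> * (l2_norm x)\<^sup>2 \<le> (l2_norm (mat_adjoint (khatri_rao_mat d l k w) *\<^sub>v x))\<^sup>2) \<longleftrightarrow> P w"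
    if w: "w \<in> space ?M" for w
  proof -
    have "(\<forall>x\<in>V. \<alpha> * (l2_norm x)\<^sup>2 \<le> (l2_norm (mat_adjoint (khatri_rao_mat d l k w) *\<^sub>v x))\<^sup>2)
      \<longleftrightarrow> (\<forall>\<theta>. 0 \<le> q w \<theta>)"
    proof
      assume *: "\<forall>x\<in>V. \<alpha> * (l2_norm x)\<^sup>2 \<le> (l2_norm (mat_adjoint (khatri_rao_mat d l k w) *\<^sub>v x))\<^sup>2"
      show "\<forall>\<theta>. 0 \<le> q w \<theta>"
      proof
        fix \<theta>
        let ?x = "vec (d ^ l) (real_comb ?m u \<theta>)"
        have "?x \<in> V"
          using u(1) by (simp add: real_comb_def[abs_def])
        then have "\<alpha> * (l2_norm ?x)\<^sup>2 \<le> (l2_norm (mat_adjoint (khatri_rao_mat d l k w) *\<^sub>v ?x))\<^sup>2"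
          using * by blast
        also have "\<dots> = sketch_energy d l k (($) ?x) w"
          using w by (intro l2_norm_sketch) auto
        also have "\<dots> = sketch_energy d l k (real_comb ?m u \<theta>) w"
          by (rule sketch_energy_cong) simp
        finally show "0 \<le> q w \<theta>"
          by (simp add: q_def l2_norm_square)
      qed
    next
      assume *: "\<forall>\<theta>. 0 \<le> q w \<theta>"
      show "\<forall>x\<in>V. \<alpha> * (l2_norm x)\<^sup>2 \<le> (l2_norm (mat_adjoint (khatri_rao_mat d l k w) *\<^sub>v x))\<^sup>2"
      proof
        fix x
        assume "x \<in> V"
        then obtain \<theta> where x: "x \<in> carrier_vec (d ^ l)" "\<And>p. p < d ^ l \<Longrightarrow> x $ p = real_comb ?m u \<theta> p"
          using u(2) unfolding real_comb_def by blast
        have "sketch_energy d l k (($) x) w = sketch_energy d l k (real_comb ?m u \<theta>) w"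
          by (rule sketch_energy_cong) (rule x)
        moreover have "(l2_norm x)\<^sup>2 = (\<Sum>p<d ^ l. (norm (real_comb ?m u \<theta> p))\<^sup>2)"
          using x by (simp add: l2_norm_square)
        moreover have "0 \<le> q w \<theta>"
          using * by blast
        ultimately show "\<alpha> * (l2_norm x)\<^sup>2 \<le> (l2_norm (mat_adjoint (khatri_rao_mat d l k w) *\<^sub>v x))\<^sup>2"
          unfolding l2_norm_sketch[OF w x(1)] q_def by simp
      qed
    qed
    also have "\<dots> \<longleftrightarrow> P w"
    proof
      assume P: "P w"
      show "\<forall>\<theta>. 0 \<le> q w \<theta>"
      proof
        fix \<theta>
        define T where "T = (\<Sum>i<?m. sketch_energy d l k (u i) w)"
        have "0 \<le> q w \<theta> + (1 / real (Suc n))\<^sup>2 / 4 * T" for n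
        proof -
          have s: "0 < 1 / real (Suc n)"
            by simp
          obtain z :: "nat \<Rightarrow> int" where
            z: "q w (\<lambda>i. 1 / real (Suc n) * of_int (z i)) \<le> q w \<theta> + (1 / real (Suc n))\<^sup>2 / 4 * T"
            using ex_rounding[OF q[of w] sketch_energy_nonneg s, of \<theta>] unfolding T_def by blast
          have "q w (\<lambda>i. 1 / real (Suc n) * of_int (z i))
              = q w (\<lambda>i. 1 / real (Suc n) * of_int (map z [0..<?m] ! i))"
            using q unfolding diag_bounded_quadratic_def by simp
          with P z show ?thesis
            unfolding P_def by (metis order_trans)
        qed
        \<comment> \<open>For fixed \<open>w\<close> the trace \<open>T\<close> is a constant, so
          the rounding error vanishes as the mesh \<open>1 / Suc n\<close> tends to 0.\<close>
        moreover have "(\<lambda>n. q w \<theta> + (1 / real (Suc n))\<^sup>2 / 4 * T) \<longlonglongrightarrow> q w \<theta> + 0\<^sup>2 / 4 * T"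
          by (intro tendsto_intros LIMSEQ_Suc[OF lim_1_over_n]) simp
        ultimately have "0 \<le> q w \<theta> + 0\<^sup>2 / 4 * T"
          by (intro LIMSEQ_le_const) auto
        then show "0 \<le> q w \<theta>"
          by simp
      qed
    qed (auto simp: P_def)
    finally show ?thesis .
  qed
  then have "{w \<in> space ?M. \<forall>x\<in>V. \<alpha> * (l2_norm x)\<^sup>2
      \<le> (l2_norm (mat_adjoint (khatri_rao_mat d l k w) *\<^sub>v x))\<^sup>2} = {w \<in> space ?M. P w}"
    by blast
  also have "\<dots> \<in> sets ?M"
    unfolding P_def q_def by measurable
  finally show ?thesis .
qed

text \<open>Two bad events, a failing grid point and a trace of at least \<open>40 * m\<close>, have
  probability at most \<open>1 / 40\<close> each. Outside both, the rounding argument applies to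
  every normalized vector of \<open>V\<close>.\<close>

lemma subspace_embedding:
  assumes V: "subspace_of_dim (d ^ l) r V" and r: "1 \<le> r" and k: "640 * C ^ l * real r \<le> real k"
  shows "19 / 20 \<le> measure (factor_space l k N) {w \<in> space (factor_space l k N).
    \<forall>x\<in>V. 1 / 2 * (l2_norm x)\<^sup>2 \<le> (l2_norm (mat_adjoint (khatri_rao_mat d l k w) *\<^sub>v x))\<^sup>2}"
    (is "_ \<le> measure ?M ?E")
proof -
  interpret M: prob_space ?M
    by (rule prob_space_factor_space)
  have h: "1 \<le> C ^ l"
    using C_ge_1 by simp
  have "0 < 640 * C ^ l * real r"
    using h r by simp
  then have "0 < real k"
    using k by (rule less_le_trans)
  then have k_pos: "0 < k"
    by simp
  define m where "m = 2 * r"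
  have m: "1 \<le> m"
    using r by (simp add: m_def)
  obtain u :: "nat \<Rightarrow> nat \<Rightarrow> 'a" where
    u1: "\<forall>i<2 * r. (\<Sum>p<d ^ l. (norm (u i p))\<^sup>2) \<le> 1"
    and "\<forall>\<theta> :: nat \<Rightarrow> real. vec (d ^ l) (\<lambda>p. \<Sum>i<2 * r. of_real (\<theta> i) * u i p) \<in> V"
    and u2: "\<forall>x\<in>V. x \<in> carrier_vec (d ^ l) \<and> (\<exists>\<theta> :: nat \<Rightarrow> real.
       (\<forall>p<d ^ l. x $ p = (\<Sum>i<2 * r. of_real (\<theta> i) * u i p)) \<and>
       (\<Sum>i<2 * r. (\<theta> i)\<^sup>2) \<le> (l2_norm x)\<^sup>2)"
    using subspace_of_dim_real_frame[OF V] .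
  note u = u1[folded m_def] u2[folded m_def]
  define x where "x z = real_comb m u (\<lambda>i. 1 / (7 * sqrt m) * of_int (z i))" for z :: "nat \<Rightarrow> int"
  define B where "B z = {w \<in> space ?M. sketch_energy d l k (x z) w
    < 3 / 4 * (\<Sum>p<d ^ l. (norm (x z p))\<^sup>2)}" for z
  define T where "T = {w \<in> space ?M. 40 * real m \<le> (\<Sum>i<m. sketch_energy d l k (u i) w)}"
  define G where "G = l1_ball m (8 * m)"
  have B_sets [measurable]: "B z \<in> sets ?M" for z
    unfolding B_def by measurable
  have T_sets [measurable]: "T \<in> sets ?M"
    unfolding T_def by measurable
  have "measure ?M (\<Union>z\<in>G. B z) \<le> (\<Sum>z\<in>G. measure ?M (B z))"
    by (rule measure_UNION_le) (auto simp: G_def finite_l1_ball)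
  also have "\<dots> \<le> (\<Sum>z\<in>G. exp (- real k / (32 * C ^ l)))"
    unfolding B_def by (intro sum_mono sketch_energy_lower_tail k_pos)
  also have "\<dots> \<le> (\<Sum>z\<in>G. exp (- 20 * real r))"
  proof (rule sum_mono)
    \<comment> \<open>Here \<open>640 = 32 * 20\<close>: the lower tail at each grid point is at
      most \<open>exp (- 20 * real r)\<close>.\<close>
    have "20 * real r \<le> real k / (32 * C ^ l)"
      using k h by (simp add: field_simps)
    then show "exp (- real k / (32 * C ^ l)) \<le> exp (- 20 * real r)"
      by simp
  qed
  also have "\<dots> = real (card G) * exp (- 20 * real r)"
    by simp
  also have "\<dots> \<le> 3 ^ (2 * r) * 2 ^ (8 * (2 * r)) * exp (- 20 * real r)"
    using card_l1_ball[of m "8 * m"] unfolding G_def m_def by (intro mult_right_mono) auto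
  also have "\<dots> \<le> 1 / 40"
    by (rule grid_union_bound[OF r])
  finally have B_bound: "measure ?M (\<Union>z\<in>G. B z) \<le> 1 / 40" .
  have trace: "has_bochner_integral ?M (\<lambda>w. \<Sum>i<m. sketch_energy d l k (u i) w)
      (\<Sum>i<m. \<Sum>p<d ^ l. (norm (u i p))\<^sup>2)"
    by (intro has_bochner_integral_sum sketch_energy_expectation k_pos)
  \<comment> \<open>Markov's inequality: the sketch preserves squared norms in mean and the frame
    vectors have norm at most 1, so the expected trace is at most \<open>m\<close>.\<close>
  have "measure ?M T \<le> (\<integral>w. (\<Sum>i<m. sketch_energy d l k (u i) w) \<partial>?M) / (40 * real m)"
    unfolding T_def using trace m
    by (intro integral_Markov_inequality_measure[where A = "{}"])
      (auto simp: has_bochner_integral_iff intro!: sum_nonneg sketch_energy_nonneg)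
  also have "\<dots> = (\<Sum>i<m. \<Sum>p<d ^ l. (norm (u i p))\<^sup>2) / (40 * real m)"
    using trace by (simp add: has_bochner_integral_iff)
  also have "\<dots> \<le> (\<Sum>i<m. 1) / (40 * real m)"
    using u(1) by (intro divide_right_mono sum_mono) auto
  also have "\<dots> = 1 / 40"
    using m by simp
  finally have T_bound: "measure ?M T \<le> 1 / 40" .
  have "space ?M - ((\<Union>z\<in>G. B z) \<union> T) \<subseteq> ?E"
  proof (intro subsetI CollectI conjI ballI)
    fix w y
    assume w: "w \<in> space ?M - ((\<Union>z\<in>G. B z) \<union> T)" and y: "y \<in> V"
    obtain \<theta> where \<theta>: "y \<in> carrier_vec (d ^ l)" "\<And>p. p < d ^ l \<Longrightarrow> y $ p = real_comb m u \<theta> p"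
      "(\<Sum>i<m. (\<theta> i)\<^sup>2) \<le> (l2_norm y)\<^sup>2"
      using u(2) y unfolding real_comb_def by blast
    have w': "w \<in> space ?M"
      using w by simp
    have energy: "(l2_norm (mat_adjoint (khatri_rao_mat d l k w) *\<^sub>v y))\<^sup>2
        = sketch_energy d l k (real_comb m u \<theta>) w"
      unfolding l2_norm_sketch[OF w' \<theta>(1)] by (rule sketch_energy_cong) (rule \<theta>)
    have norm_y: "(l2_norm y)\<^sup>2 = (\<Sum>p<d ^ l. (norm (real_comb m u \<theta> p))\<^sup>2)"
      using \<theta> by (simp add: l2_norm_square)
    show "1 / 2 * (l2_norm y)\<^sup>2 \<le> (l2_norm (mat_adjoint (khatri_rao_mat d l k w) *\<^sub>v y))\<^sup>2"
    proof (cases "l2_norm y = 0")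
      case True
      then show ?thesis
        by simp
    next
      case False
      \<comment> \<open>Both sides are homogeneous of degree 2, so the bound for unit vectors is
        applied to \<open>y\<close> divided by its norm.\<close>
      define c where "c = 1 / l2_norm y"
      have c: "c\<^sup>2 * (l2_norm y)\<^sup>2 = 1"
        using False by (simp add: c_def power_divide)
      have comb: "real_comb m u (\<lambda>i. c * \<theta> i) = (\<lambda>p. of_real c * real_comb m u \<theta> p)"
        by (rule ext) (rule real_comb_scale)
      have "1 / 2 \<le> sketch_energy d l k (real_comb m u (\<lambda>i. c * \<theta> i)) w"
      proof (rule energy_lower_bound_from_grid[OF m])
        show "3 / 4 * (\<Sum>p<d ^ l. (norm (real_comb m u (\<lambda>i. 1 / (7 * sqrt m) * of_int (z i)) p))\<^sup>2)
            \<le> sketch_energy d l k (real_comb m u (\<lambda>i. 1 / (7 * sqrt m) * of_int (z i))) w"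
          if "z \<in> l1_ball m (8 * m)" for z
          using w that by (auto simp: B_def G_def x_def not_less)
        show "(\<Sum>i<m. sketch_energy d l k (u i) w) \<le> 40 * real m"
          using w by (auto simp: T_def)
        have "(\<Sum>i<m. (c * \<theta> i)\<^sup>2) = c\<^sup>2 * (\<Sum>i<m. (\<theta> i)\<^sup>2)"
          by (simp add: power_mult_distrib sum_distrib_left)
        also have "\<dots> \<le> c\<^sup>2 * (l2_norm y)\<^sup>2"
          using \<theta>(3) by (intro mult_left_mono) auto
        finally show "(\<Sum>i<m. (c * \<theta> i)\<^sup>2) \<le> 1"
          using c by simp
        show "(\<Sum>p<d ^ l. (norm (real_comb m u (\<lambda>i. c * \<theta> i) p))\<^sup>2) = 1"
          unfolding real_comb_scale using c
          by (simp add: norm_mult power_mult_distrib sum_distrib_left[symmetric] norm_y)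
      qed
      also have "\<dots> = c\<^sup>2 * sketch_energy d l k (real_comb m u \<theta>) w"
        unfolding comb sketch_energy_scale by simp
      finally have "1 / 2 * (l2_norm y)\<^sup>2
          \<le> c\<^sup>2 * sketch_energy d l k (real_comb m u \<theta>) w * (l2_norm y)\<^sup>2"
        by (rule mult_right_mono) simp
      also have "\<dots> = c\<^sup>2 * (l2_norm y)\<^sup>2 * sketch_energy d l k (real_comb m u \<theta>) w"
        by simp
      finally show ?thesis
        unfolding energy c by simp
    qed
  qed auto
  then have "measure ?M (space ?M - ((\<Union>z\<in>G. B z) \<union> T)) \<le> measure ?M ?E"
    by (rule M.finite_measure_mono[OF _ embedding_event_measurable[OF V]]) simp
  moreover have UB: "(\<Union>z\<in>G. B z) \<in> sets ?M"
    by (rule sets.finite_UN) (auto simp: G_def finite_l1_ball)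
  moreover have "measure ?M (space ?M - ((\<Union>z\<in>G. B z) \<union> T)) = 1 - measure ?M ((\<Union>z\<in>G. B z) \<union> T)"
    using UB by (intro M.prob_compl) auto
  moreover have "measure ?M ((\<Union>z\<in>G. B z) \<union> T) \<le> measure ?M (\<Union>z\<in>G. B z) + measure ?M T"
    using UB by (intro measure_Un_le) auto
  ultimately show ?thesis
    using B_bound T_bound by linarith
qed

lemma osi_khatri_rao:
  assumes r: "1 \<le> r"
  shows "\<exists>k. real k \<le> 641 * C ^ l * real r \<and>
    osi (factor_space l k N) (d ^ l) k (khatri_rao_mat d l k) r (1 / 2)"
proof -
  \<comment> \<open>Rounding up costs at most 1, which is at most \<open>C ^ l * real r\<close>;
    this turns 640 into 641.\<close>
  define k where "k = nat \<lceil>640 * C ^ l * real r\<rceil>"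
  have h: "1 \<le> C ^ l * real r"
    using C_ge_1 r mult_mono[of 1 "C ^ l" 1 "real r"] by simp
  have k: "640 * C ^ l * real r \<le> real k" "real k \<le> 641 * C ^ l * real r"
    using h by (simp_all add: k_def) linarith+
  have "real r \<le> C ^ l * real r"
    using C_ge_1 by (simp add: mult_le_cancel_right1)
  then have "r \<le> k"
    using k by simp
  then have k_pos: "0 < k"
    using r by simp
  have "has_bochner_integral (factor_space l k N)
      (\<lambda>w. (l2_norm (mat_adjoint (khatri_rao_mat d l k w) *\<^sub>v x))\<^sup>2) ((l2_norm x)\<^sup>2)"
    if x: "x \<in> carrier_vec (d ^ l)" for x
  proof -
    have "(l2_norm x)\<^sup>2 = (\<Sum>p<d ^ l. (norm (x $ p))\<^sup>2)"
      using x by (simp add: l2_norm_square)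
    then show ?thesis
      using sketch_energy_expectation[OF k_pos, of l "($) x"]
      by (subst has_bochner_integral_cong[OF refl l2_norm_sketch[OF _ x]])
  qed
  then have "osi (factor_space l k N) (d ^ l) k (khatri_rao_mat d l k) r (1 / 2)"
    unfolding osi_def has_bochner_integral_iff
    using random_mat_khatri_rao subspace_embedding[OF _ r k(1)] \<open>r \<le> k\<close> by auto
  then show ?thesis
    using k(2) by blast
qed

end

section \<open>One universal constant for real and complex scalars\<close>

theorem theorem5p1:
  shows "\<exists>K::real. K > 0 \<and>
    (\<forall>(d0::nat) (l::nat) (r::nat) (C::real) (N :: real vec measure).
        d0 \<ge> 1 \<longrightarrow> r \<ge> 1 \<longrightarrow>
        vec_distribution d0 N \<longrightarrow> isotropic d0 N \<longrightarrow> fourth_moment_bound d0 N C \<longrightarrow>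
        (\<exists>k::nat. real k \<le> K * C ^ l * real r \<and>
           osi (factor_space l k N) (d0 ^ l) k (khatri_rao_mat d0 l k) r (1 / 2))) \<and>
    (\<forall>(d0::nat) (l::nat) (r::nat) (C::real) (N :: complex vec measure).
        d0 \<ge> 1 \<longrightarrow> r \<ge> 1 \<longrightarrow>
        vec_distribution d0 N \<longrightarrow> isotropic d0 N \<longrightarrow> fourth_moment_bound d0 N C \<longrightarrow>
        (\<exists>k::nat. real k \<le> K * C ^ l * real r \<and>
           osi (factor_space l k N) (d0 ^ l) k (khatri_rao_mat d0 l k) r (1 / 2)))"
proof (intro exI[of _ "641 :: real"] conjI allI impI)
  show "(0 :: real) < 641"
    by simp
qed (rule base_distribution.osi_khatri_rao, unfold_locales; assumption)+

end
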